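(* There exists an algorithm which, given {\sf NACOND} access to two unknown distributions $p, q$ on $[n]$ and a parameter $\varepsilon \in (0,1]$, makes $\tilde O\left(\frac{\log^{12} n}{\varepsilon^2}\right)$ queries to the oracle of each distribution and distinguishes between the cases $p = q$ and $d_{\mathrm{TV}}(p,q) \geq \varepsilon$ with probability at least $2/3$ (i.e., in each of the two cases it outputs the correct answer with probability at least $2/3$).
   Context: Distributions are over the finite domain $[n]=\{1,\dots,n\}$; for $S\subseteq[n]$, $p(S)=\sum_{i\in S}p(i)$, and $p_S$ is the conditional distribution $p_S(i)=p(i)/p(S)$ for $i \in S$. A conditional sampling oracle for $p$ takes as input a query set $S\subseteq[n]$ and returns a symbol $i\in S$ drawn with probability $p(i)/p(S)$; if $p(S)=0$ it returns a uniformly random element of $S$. In the non-adaptive model ({\sf NACOND}), the algorithm must specify all of its query sets (possibly using its own randomness) before seeing the result of any query. Total variation distance: $d_{\mathrm{TV}}(p,q)=\frac12\sum_{i\in[n]}|p(i)-q(i)|$. $\log$ denotes base-2 logarithm; $\tilde O(\cdot)$ hides factors polylogarithmic in its argument (here, factors polynomial in $\log\log n$ and $\log(1/\varepsilon)$). *)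

theory Defs
  imports "HOL-Probability.Probability"
begin

definition is_dist_on :: "nat \<Rightarrow> nat pmf \<Rightarrow> bool" where
  "is_dist_on n p \<longleftrightarrow> set_pmf p \<subseteq> {1..n}"

definition d_TV :: "nat \<Rightarrow> nat pmf \<Rightarrow> nat pmf \<Rightarrow> real" where
  "d_TV n p q = (1/2) * (\<Sum>i\<in>{1..n}. \<bar>pmf p i - pmf q i\<bar>)"

definition cond_oracle :: "nat pmf \<Rightarrow> nat set \<Rightarrow> nat pmf" where
  "cond_oracle p S = (if measure_pmf.prob p S = 0 then pmf_of_set S else cond_pmf p S)"

fun cond_answers :: "nat pmf \<Rightarrow> nat set list \<Rightarrow> nat list pmf" where
  "cond_answers p [] = return_pmf []"
| "cond_answers p (S # Ss) =
     bind_pmf (cond_oracle p S) (\<lambda>x. bind_pmf (cond_answers p Ss) (\<lambda>xs. return_pmf (x # xs)))"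

text \<open>A non-adaptive conditional-sampling tester for a pair of distributions:
  it first draws (with its own randomness) a seed together with ALL query sets
  for p and for q (the "plan"), then receives the oracle answers and outputs a
  (possibly randomized) decision; True means "p = q".\<close>
type_synonym nacond_plan = "nat \<times> nat set list \<times> nat set list"
type_synonym nacond_alg = "nacond_plan pmf \<times> (nacond_plan \<Rightarrow> nat list \<Rightarrow> nat list \<Rightarrow> bool pmf)"

definition run_nacond :: "nacond_alg \<Rightarrow> nat pmf \<Rightarrow> nat pmf \<Rightarrow> bool pmf" where
  "run_nacond A p q =
     bind_pmf (fst A) (\<lambda>pl.
       bind_pmf (cond_answers p (fst (snd pl))) (\<lambda>ap.
         bind_pmf (cond_answers q (snd (snd pl))) (\<lambda>aq. snd A pl ap aq)))"

definition nacond_valid :: "nat \<Rightarrow> real \<Rightarrow> nacond_alg \<Rightarrow> bool" where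
  "nacond_valid n m A \<longleftrightarrow>
     (\<forall>pl \<in> set_pmf (fst A).
        (\<forall>S \<in> set (fst (snd pl)) \<union> set (snd (snd pl)). S \<noteq> {} \<and> S \<subseteq> {1..n}) \<and>
        real (length (fst (snd pl))) \<le> m \<and> real (length (snd (snd pl))) \<le> m)"

end

theory Submission
  imports Defs
begin

text \<open>
  Write \<open>\<mu> = (p + q) / 2\<close> and \<open>d = (p - q) / 2\<close>. For an element \<open>i\<close> of a query set \<open>S\<close>, the difference
  \<open>p\<^sub>S(i) - q\<^sub>S(i)\<close> is at least of order \<open>d(i) \<mu>(S) - \<mu>(i) d(S)\<close> divided by \<open>\<mu>(S)\<^sup>2\<close>, so it detects
  that the ratio \<open>d/\<mu>\<close> at \<open>i\<close> deviates from its average over \<open>S\<close>. Let \<open>L\<^sub>t\<close> be the set of elements of mass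
  at most \<open>2\<^sup>-\<^sup>t\<close> and \<open>B\<^sub>l\<close> the dyadic bucket of mass about \<open>2\<^sup>-\<^sup>l\<close>. Given \<open>l\<close>, take the \<open>t \<le> l\<close> that
  minimizes \<open>\<rho> = 2\<^sup>-\<^sup>t / \<mu>(L\<^sub>t)\<close>. If for every \<open>l\<close> the ratios \<open>d/\<mu>\<close> in \<open>B\<^sub>l\<close> were close to the average over
  \<open>L\<^sub>t\<close>, all these averages would be close to the average over everything, which is \<open>0\<close>, and \<open>p\<close> would be
  close to \<open>q\<close>. Otherwise consider a bad bucket. By minimality of \<open>\<rho>\<close> there are at most
  \<open>O(l / \<rho>)\<close> elements heavier than \<open>2\<^sup>-\<^sup>t\<close>, so a random set of density about \<open>\<rho> / log (n/\<epsilon>)\<close> avoids them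
  with constant probability, while its mass in \<open>L\<^sub>t\<close> has exponential tails on the scale \<open>2\<^sup>-\<^sup>t\<close>. Hence
  an element of \<open>B\<^sub>l\<close> in the set is visible, and the expectation of \<open>max\<^sub>i |p\<^sub>S(i) - q\<^sub>S(i)|\<close> is at least
  \<open>\<delta> = \<epsilon> / log\<^sup>5 n\<close> up to lower-order factors, for a random density \<open>2\<^sup>-\<^sup>j\<close>.

  So some level \<open>\<tau> = 2\<^sup>-\<^sup>t\<close> is exceeded with probability about \<open>\<delta> / \<tau>\<close>. Querying \<open>1 / (\<delta> 2\<^sup>t)\<close> random
  sets about \<open>4\<^sup>t log n\<close> times each, for every \<open>t\<close>, finds it at cost \<open>log n / \<delta>\<^sup>2\<close>, i.e. \<open>log\<^sup>1\<^sup>1 n / \<epsilon>\<^sup>2\<close>.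
\<close>

section \<open>Dyadic buckets\<close>

definition light :: "('a \<Rightarrow> real) \<Rightarrow> 'a set \<Rightarrow> nat \<Rightarrow> 'a set" where
  "light \<mu> A l = {i \<in> A. \<mu> i \<le> (1/2) ^ l}"

definition bucket :: "('a \<Rightarrow> real) \<Rightarrow> 'a set \<Rightarrow> nat \<Rightarrow> 'a set" where
  "bucket \<mu> A l = light \<mu> A l - light \<mu> A (Suc l)"

lemma light_Suc_subset: "light \<mu> A (Suc l) \<subseteq> light \<mu> A l"
proof -
  have "(1/2 :: real) ^ Suc l \<le> (1/2) ^ l"
    by simp
  then show ?thesis
    unfolding light_def by (auto elim: order_trans simp del: power_Suc)
qed

lemma light_antimono: "l \<le> l' \<Longrightarrow> light \<mu> A l' \<subseteq> light \<mu> A l"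
  by (rule lift_Suc_antimono_le[of "light \<mu> A", OF light_Suc_subset])

lemma light_subset: "light \<mu> A l \<subseteq> A"
  by (auto simp: light_def)

lemma bucket_subset_light: "bucket \<mu> A l \<subseteq> light \<mu> A l"
  by (auto simp: bucket_def)

lemma sum_light_split:
  fixes f :: "'a \<Rightarrow> real"
  assumes "finite A"
  shows "sum f (light \<mu> A l) = sum f (bucket \<mu> A l) + sum f (light \<mu> A (Suc l))"
  unfolding bucket_def using light_Suc_subset[of \<mu> A l] finite_subset[OF light_subset assms]
  by (simp add: sum.subset_diff)

lemma sum_light_telescope:
  fixes f :: "'a \<Rightarrow> real"
  assumes "finite A" "t \<le> l"
  shows "sum f (light \<mu> A t) = (\<Sum>k=t..<l. sum f (bucket \<mu> A k)) + sum f (light \<mu> A l)"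
  using assms(2)
proof (induction l rule: dec_induct)
  case (step l)
  then show ?case using sum_light_split[OF assms(1), of f \<mu> l] by simp
qed simp

text \<open>Minimality of \<open>(1/2) ^ k / M k\<close>, cross-multiplied so that later estimates
  need no division. A minimizer over \<open>{..l}\<close> is also minimal over every shorter initial
  range containing it, so one \<open>t\<close> serves all buckets from \<open>t\<close> to
  \<open>l\<close>.\<close>

lemma exists_ratio_minimizer:
  fixes M :: "nat \<Rightarrow> real"
  assumes pos: "\<And>k. k \<le> l \<Longrightarrow> M k > 0"
  shows "\<exists>t\<le>l. \<forall>k\<le>l. (1/2) ^ t * M k \<le> (1/2) ^ k * M t"
proof -
  let ?f = "\<lambda>k. (1/2) ^ k / M k"
  obtain t where t: "t \<le> l" "\<And>k. k \<le> l \<Longrightarrow> ?f t \<le> ?f k"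
    using arg_min_if_finite[of "{..l}" ?f] by (auto simp: not_less)
  have "(1/2) ^ t * M k \<le> (1/2) ^ k * M t" if "k \<le> l" for k
    using t(2)[OF that] pos[OF t(1)] pos[OF that] by (simp add: field_simps)
  then show ?thesis using t(1) by blast
qed

text \<open>
  The averages are propagated downwards: if all buckets from \<open>t\<close> to \<open>l - 1\<close> have ratio close to that
  of \<open>L\<^sub>t\<close>, then so has what is left, \<open>L\<^sub>l\<close>. Since \<open>M t \<ge> M l\<close>, the error stays additive and is never
  divided by a small mass.
\<close>

lemma exists_discrepant_bucket:
  fixes \<mu> d :: "'a \<Rightarrow> real"
  assumes fin: "finite A"
    and bnd: "\<And>i. i \<in> A \<Longrightarrow> \<bar>d i\<bar> \<le> \<mu> i"
    and one: "sum \<mu> A = 1" and zero: "sum d A = 0" and D: "D \<ge> 0"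
    and far: "(\<Sum>i\<in>A. \<bar>d i\<bar>) > D * (real J + 1)\<^sup>2 + sum \<mu> (light \<mu> A (Suc J))"
  defines "M \<equiv> \<lambda>l. sum \<mu> (light \<mu> A l)" and "R \<equiv> \<lambda>l. sum d (light \<mu> A l)"
  shows "\<exists>t l. t \<le> l \<and> l \<le> J \<and> M t > 0 \<and> (\<forall>k\<le>l. (1/2) ^ t * M k \<le> (1/2) ^ k * M t) \<and>
    (\<Sum>i\<in>bucket \<mu> A l. \<bar>d i * M t - \<mu> i * R t\<bar>) > D * (M t)\<^sup>2"
proof (rule ccontr)
  assume "\<not> ?thesis"
  then have close: "(\<Sum>i\<in>bucket \<mu> A l. \<bar>d i * M t - \<mu> i * R t\<bar>) \<le> D * (M t)\<^sup>2"
    if "t \<le> l" "l \<le> J" "M t > 0" "\<forall>k\<le>l. (1/2) ^ t * M k \<le> (1/2) ^ k * M t" for t l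
    using that by (meson not_less)
  have nonneg: "\<mu> i \<ge> 0" if "i \<in> A" for i
    using bnd[OF that] by linarith
  have finL: "finite (light \<mu> A l)" for l
    using fin light_subset finite_subset by metis
  have M_anti: "M l' \<le> M l" if "l \<le> l'" for l l'
    unfolding M_def using nonneg
    by (intro sum_mono2[OF finL light_antimono[OF that]]) (auto simp: light_def)
  have M_nonneg: "M l \<ge> 0" for l
    unfolding M_def using nonneg by (intro sum_nonneg) (auto simp: light_def)
  have "\<mu> i \<le> 1" if "i \<in> A" for i
    using member_le_sum[OF that, of \<mu>] nonneg fin one by auto
  then have light0: "light \<mu> A 0 = A"
    by (auto simp: light_def)
  have M_le1: "M l \<le> 1" for l
    using M_anti[of 0 l] one by (simp add: M_def light0)
  have absR: "\<bar>R l\<bar> \<le> M l" for l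
    unfolding R_def M_def using bnd
    by (intro order_trans[OF sum_abs] sum_mono) (auto simp: light_def)
  have minimizer: "\<exists>t\<le>l. M t > 0 \<and> (\<forall>k\<le>l. (1/2) ^ t * M k \<le> (1/2) ^ k * M t)" if "M l > 0" for l
    using exists_ratio_minimizer[of l M] M_anti that by (meson less_le_trans)
  \<comment> \<open>The unnormalized \<open>R l\<close> is bounded, not the average
    \<open>R l / M l\<close>: the induction starts from \<open>R 0 = 0\<close>, and each bucket
    passed costs at most one \<open>D\<close>.\<close>
  have Rbound: "\<bar>R l\<bar> \<le> D * l" if "l \<le> Suc J" for l
    using that
  proof (induction l rule: less_induct)
    case (less l)
    show ?case
    proof (cases "l = 0 \<or> M (l - 1) = 0")
      case True
      then have "R l = 0"
        using zero M_anti[of "l - 1" l] absR[of l] by (auto simp: R_def light0)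
      then show ?thesis using D by simp
    next
      case False
      then have "M (l - 1) > 0" using M_nonneg[of "l - 1"] by linarith
      \<comment> \<open>The minimizer for \<open>l - 1\<close> lies strictly below \<open>l\<close>,
        so the induction hypothesis applies to it, and it makes \<open>close\<close> available for
        every bucket from \<open>t\<close> to \<open>l - 1\<close>; these indices are at most
        \<open>J\<close>.\<close>
      then obtain t where t: "t \<le> l - 1" "M t > 0"
        "\<forall>k\<le>l - 1. (1/2) ^ t * M k \<le> (1/2) ^ k * M t"
        using minimizer by blast
      have tl: "t < l" using t(1) False by auto
      define e where "e k = sum d (bucket \<mu> A k) * M t - sum \<mu> (bucket \<mu> A k) * R t" for k
      have e: "\<bar>e k\<bar> \<le> D * (M t)\<^sup>2" if "k \<in> {t..<l}" for k
      proof -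
        have "e k = (\<Sum>i\<in>bucket \<mu> A k. d i * M t - \<mu> i * R t)"
          by (simp add: e_def sum_subtractf sum_distrib_right)
        also have "\<bar>\<dots>\<bar> \<le> (\<Sum>i\<in>bucket \<mu> A k. \<bar>d i * M t - \<mu> i * R t\<bar>)"
          by (rule sum_abs)
        also have "\<dots> \<le> D * (M t)\<^sup>2"
          using that t less.prems by (intro close) auto
        finally show ?thesis .
      qed
      have "\<bar>\<Sum>k=t..<l. e k\<bar> \<le> (\<Sum>k=t..<l. D * (M t)\<^sup>2)"
        using e by (intro order_trans[OF sum_abs] sum_mono) auto
      also have "\<dots> = real (l - t) * D * (M t)\<^sup>2" by simp
      finally have e_sum: "\<bar>\<Sum>k=t..<l. e k\<bar> \<le> real (l - t) * D * (M t)\<^sup>2" .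
      \<comment> \<open>The buckets telescope to the difference of two light sets; the terms
        \<open>R t * M t\<close> then cancel.\<close>
      have "(\<Sum>k=t..<l. e k) = (R t - R l) * M t - (M t - M l) * R t"
        using sum_light_telescope[OF fin, of t l d \<mu>] sum_light_telescope[OF fin, of t l \<mu> \<mu>] tl
        by (simp add: e_def sum_subtractf R_def M_def flip: sum_distrib_right)
      then have "M t * R l = M l * R t - (\<Sum>k=t..<l. e k)"
        by (simp add: algebra_simps)
      then have "M t * \<bar>R l\<bar> \<le> M l * \<bar>R t\<bar> + \<bar>\<Sum>k=t..<l. e k\<bar>"
        using abs_triangle_ineq4[of "M l * R t" "\<Sum>k=t..<l. e k"] t(2) M_nonneg[of l]
        by (metis abs_mult abs_of_nonneg less_imp_le)
      also have "\<dots> \<le> M t * (D * t) + real (l - t) * D * (M t)\<^sup>2"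
        using less.IH[of t] tl less.prems M_anti[of t l] M_nonneg e_sum
        by (intro add_mono mult_mono) auto
      also have "real (l - t) * D * (M t)\<^sup>2 \<le> real (l - t) * D * (M t * 1)"
        unfolding power2_eq_square using M_le1[of t] M_nonneg D by (intro mult_left_mono) auto
      also have "M t * (D * t) + real (l - t) * D * (M t * 1) = M t * (D * l)"
        using tl by (simp add: of_nat_diff algebra_simps)
      finally show ?thesis using t(2) by simp
    qed
  qed
  have Bbound: "(\<Sum>i\<in>bucket \<mu> A l. \<bar>d i\<bar>) \<le> D * (real J + 1)" if l: "l \<le> J" for l
  proof (cases "M l = 0")
    case True
    have "(\<Sum>i\<in>bucket \<mu> A l. \<bar>d i\<bar>) \<le> M l"
      unfolding M_def using bnd nonneg
      by (intro order_trans[OF sum_mono[of _ _ \<mu>] sum_mono2[OF finL bucket_subset_light]])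
        (auto simp: light_def bucket_def)
    moreover have "D * (real J + 1) \<ge> 0" using D by simp
    ultimately show ?thesis using True by linarith
  next
    case False
    then have "M l > 0" using M_nonneg[of l] by linarith
    then obtain t where t: "t \<le> l" "M t > 0" "\<forall>k\<le>l. (1/2) ^ t * M k \<le> (1/2) ^ k * M t"
      using minimizer by blast
    have B: "sum \<mu> (bucket \<mu> A l) \<le> M t"
      unfolding M_def using nonneg
      by (intro sum_mono2[OF finL order_trans[OF bucket_subset_light light_antimono[OF t(1)]]])
        (auto simp: light_def)
    have mu_B: "\<mu> i \<ge> 0" if "i \<in> bucket \<mu> A l" for i
      using that nonneg by (auto simp: bucket_def light_def)
    \<comment> \<open>Here \<open>d i * M t\<close> is compared with \<open>\<mu> i * R t\<close>,
      which is small by \<open>Rbound\<close>. Both error terms keep a factor \<open>M t\<close>, as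
      the bucket lies in \<open>light \<mu> A t\<close>, so dividing by \<open>M t\<close> at the
      end loses nothing.\<close>
    have "(\<Sum>i\<in>bucket \<mu> A l. \<bar>d i\<bar>) * M t
        \<le> (\<Sum>i\<in>bucket \<mu> A l. \<bar>d i * M t - \<mu> i * R t\<bar> + \<mu> i * \<bar>R t\<bar>)"
      unfolding sum_distrib_right
    proof (intro sum_mono)
      fix i assume "i \<in> bucket \<mu> A l"
      then show "\<bar>d i\<bar> * M t \<le> \<bar>d i * M t - \<mu> i * R t\<bar> + \<mu> i * \<bar>R t\<bar>"
        using abs_triangle_ineq[of "d i * M t - \<mu> i * R t" "\<mu> i * R t"] mu_B t(2)
        by (simp add: abs_mult)
    qed
    also have "\<dots> = (\<Sum>i\<in>bucket \<mu> A l. \<bar>d i * M t - \<mu> i * R t\<bar>) + sum \<mu> (bucket \<mu> A l) * \<bar>R t\<bar>"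
      by (simp add: sum.distrib sum_distrib_right)
    also have "\<dots> \<le> D * (M t)\<^sup>2 + M t * (D * t)"
      using close[OF t(1) l t(2,3)] B Rbound[of t] t l M_nonneg
      by (intro add_mono mult_mono) auto
    also have "D * (M t)\<^sup>2 \<le> D * (M t * 1)"
      unfolding power2_eq_square using M_le1[of t] M_nonneg D by (intro mult_left_mono) auto
    also have "D * (M t * 1) + M t * (D * t) = (D * (t + 1)) * M t"
      by (simp add: algebra_simps)
    finally have "(\<Sum>i\<in>bucket \<mu> A l. \<bar>d i\<bar>) \<le> D * (t + 1)"
      using t(2) by simp
    also have "\<dots> \<le> D * (real J + 1)"
      using t(1) l D by (intro mult_left_mono) auto
    finally show ?thesis .
  qed
  have "(\<Sum>i\<in>A. \<bar>d i\<bar>) = (\<Sum>l=0..<Suc J. \<Sum>i\<in>bucket \<mu> A l. \<bar>d i\<bar>) + (\<Sum>i\<in>light \<mu> A (Suc J). \<bar>d i\<bar>)"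
    using sum_light_telescope[OF fin, of 0 "Suc J" "\<lambda>i. \<bar>d i\<bar>" \<mu>] light0 by simp
  also have "\<dots> \<le> (\<Sum>l=0..<Suc J. D * (real J + 1)) + sum \<mu> (light \<mu> A (Suc J))"
    using Bbound bnd by (intro add_mono sum_mono) (auto simp: light_def)
  also have "\<dots> = D * (real J + 1)\<^sup>2 + sum \<mu> (light \<mu> A (Suc J))"
    by (simp add: power2_eq_square algebra_simps)
  finally show False using far by linarith
qed

section \<open>Random subsets\<close>

definition subset_weight :: "real \<Rightarrow> 'a set \<Rightarrow> 'a set \<Rightarrow> real" where
  "subset_weight \<sigma> A S = (\<Prod>i\<in>S. \<sigma>) * (\<Prod>i\<in>A - S. 1 - \<sigma>)"

lemma subset_weight_nonneg: "0 \<le> \<sigma> \<Longrightarrow> \<sigma> \<le> 1 \<Longrightarrow> 0 \<le> subset_weight \<sigma> A S"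
  unfolding subset_weight_def by (intro mult_nonneg_nonneg prod_nonneg) auto

text \<open>Elements are included independently, so the expectation of a product of one-element
  factors is the product of their expectations; \<open>prod_add\<close> expands it over the
  subsets.\<close>

lemma sum_subset_weight_prod:
  assumes "finite A"
  shows "(\<Sum>S\<in>Pow A. subset_weight \<sigma> A S * ((\<Prod>i\<in>S. g i) * (\<Prod>i\<in>A - S. h i)))
    = (\<Prod>i\<in>A. \<sigma> * g i + (1 - \<sigma>) * h i)"
  unfolding prod_add[OF assms] subset_weight_def
  by (intro sum.cong) (simp_all add: prod.distrib mult_ac)

lemma prod_of_bool: "finite S \<Longrightarrow> (\<Prod>i\<in>S. of_bool (P i) :: real) = of_bool (\<forall>i\<in>S. P i)"
  by (induction S rule: finite_induct) auto

text \<open>The event is a product of conditions on single elements: those outside \<open>L\<close>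
  are excluded, \<open>i\<close> and \<open>a\<close> are included, and the rest of \<open>L\<close>
  is free and contributes the factor \<open>1\<close>.\<close>

lemma sum_subset_weight_pair:
  assumes "finite A" "L \<subseteq> A" "i \<in> L" "a \<in> L" "i \<noteq> a"
  shows "(\<Sum>S\<in>Pow A. subset_weight \<sigma> A S * of_bool (S \<subseteq> L \<and> i \<in> S \<and> a \<in> S))
    = \<sigma>\<^sup>2 * (1 - \<sigma>) ^ card (A - L)"
proof -
  have "(\<Sum>S\<in>Pow A. subset_weight \<sigma> A S * of_bool (S \<subseteq> L \<and> i \<in> S \<and> a \<in> S)) =
    (\<Sum>S\<in>Pow A. subset_weight \<sigma> A S *
      ((\<Prod>x\<in>S. of_bool (x \<in> L)) * (\<Prod>x\<in>A - S. of_bool (x \<noteq> i \<and> x \<noteq> a))))"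
  proof (intro sum.cong refl arg_cong2[of _ _ _ _ "(*)"])
    fix S assume "S \<in> Pow A"
    then have fin: "finite S" "finite (A - S)" using assms(1) finite_subset by auto
    show "of_bool (S \<subseteq> L \<and> i \<in> S \<and> a \<in> S) = (\<Prod>x\<in>S. of_bool (x \<in> L)) *
        (\<Prod>x\<in>A - S. of_bool (x \<noteq> i \<and> x \<noteq> a) :: real)"
      unfolding prod_of_bool[OF fin(1)] prod_of_bool[OF fin(2)] of_bool_conj[symmetric]
      using assms by (intro arg_cong[of _ _ of_bool]) auto
  qed
  also have "\<dots> = (\<Prod>x\<in>A. \<sigma> * of_bool (x \<in> L) + (1 - \<sigma>) * of_bool (x \<noteq> i \<and> x \<noteq> a))"
    by (rule sum_subset_weight_prod[OF assms(1)])
  also have "\<dots> = (\<Prod>x\<in>L. \<sigma> * of_bool (x \<in> L) + (1 - \<sigma>) * of_bool (x \<noteq> i \<and> x \<noteq> a)) *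
      (\<Prod>x\<in>A - L. \<sigma> * of_bool (x \<in> L) + (1 - \<sigma>) * of_bool (x \<noteq> i \<and> x \<noteq> a))"
    using assms by (simp add: prod.subset_diff mult.commute)
  also have "(\<Prod>x\<in>L. \<sigma> * of_bool (x \<in> L) + (1 - \<sigma>) * of_bool (x \<noteq> i \<and> x \<noteq> a)) = (\<Prod>x\<in>{i, a}. \<sigma>)"
    using assms finite_subset[OF assms(2,1)] by (intro prod.mono_neutral_cong_right) auto
  also have "(\<Prod>x\<in>A - L. \<sigma> * of_bool (x \<in> L) + (1 - \<sigma>) * of_bool (x \<noteq> i \<and> x \<noteq> a)) = (\<Prod>x\<in>A - L. 1 - \<sigma>)"
    using assms by (intro prod.cong) auto
  finally show ?thesis using assms by (simp add: power2_eq_square)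
qed

text \<open>Squaring \<open>exp (u/2) \<le> 1 + u\<close> reaches all of \<open>[0, 2]\<close>, the
  range of the weights \<open>\<mu> i / c + of_bool (i \<in> B)\<close> used below.\<close>

lemma exp_le_one_plus_four_times:
  fixes u :: real
  assumes "0 \<le> u" "u \<le> 2"
  shows "exp u \<le> 1 + 4 * u"
proof -
  have "exp (u/2) \<le> 1 + u/2 + (u/2)\<^sup>2"
    using assms by (intro exp_bound) auto
  also have "(u/2)\<^sup>2 \<le> u/2"
    unfolding power2_eq_square using assms mult_left_le_one_le[of "u/2" "u/2"] by simp
  finally have "exp (u/2) \<le> 1 + u" by simp
  then have "exp (u/2) ^ 2 \<le> (1 + u)\<^sup>2"
    by (intro power_mono) auto
  then have "exp u \<le> (1 + u)\<^sup>2"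
    by (simp flip: exp_of_nat_mult)
  also have "\<dots> \<le> 1 + 4 * u"
    using assms mult_left_mono[of u 2 u] by (simp add: power2_eq_square algebra_simps)
  finally show ?thesis .
qed

text \<open>By independence one factor suffices: \<open>1 + \<sigma> * (exp (u i) - 1) \<le> exp (4
  * \<sigma> * u i)\<close> on \<open>L\<close>, and \<open>1 - \<sigma> \<le> 1\<close>
  outside.\<close>

lemma sum_subset_weight_exp_le:
  assumes fin: "finite A" and L: "L \<subseteq> A" and \<sigma>: "0 \<le> \<sigma>" "\<sigma> \<le> 1"
    and u: "\<And>i. i \<in> L \<Longrightarrow> 0 \<le> u i \<and> u i \<le> 2"
  shows "(\<Sum>S\<in>Pow A. subset_weight \<sigma> A S * (of_bool (S \<subseteq> L) * exp (sum u S)))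
    \<le> exp (4 * \<sigma> * sum u L)"
proof -
  have "(\<Sum>S\<in>Pow A. subset_weight \<sigma> A S * (of_bool (S \<subseteq> L) * exp (sum u S))) =
    (\<Sum>S\<in>Pow A. subset_weight \<sigma> A S * ((\<Prod>x\<in>S. of_bool (x \<in> L) * exp (u x)) * (\<Prod>x\<in>A - S. 1)))"
  proof (rule sum.cong[OF refl], rule arg_cong[of _ _ "(*) _"])
    fix S assume "S \<in> Pow A"
    then have "finite S" using fin finite_subset by auto
    then show "of_bool (S \<subseteq> L) * exp (sum u S) =
        (\<Prod>x\<in>S. of_bool (x \<in> L) * exp (u x)) * (\<Prod>x\<in>A - S. 1)"
      by (auto simp: prod.distrib prod_of_bool exp_sum)
  qed
  also have "\<dots> = (\<Prod>x\<in>A. \<sigma> * (of_bool (x \<in> L) * exp (u x)) + (1 - \<sigma>) * 1)"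
    by (rule sum_subset_weight_prod[OF fin])
  also have "\<dots> \<le> (\<Prod>x\<in>A. exp (of_bool (x \<in> L) * (4 * \<sigma> * u x)))"
  proof (intro prod_mono conjI)
    fix x assume "x \<in> A"
    show "0 \<le> \<sigma> * (of_bool (x \<in> L) * exp (u x)) + (1 - \<sigma>) * 1"
      using \<sigma> by simp
    show "\<sigma> * (of_bool (x \<in> L) * exp (u x)) + (1 - \<sigma>) * 1 \<le> exp (of_bool (x \<in> L) * (4 * \<sigma> * u x))"
    proof (cases "x \<in> L")
      case True
      then have "\<sigma> * exp (u x) + (1 - \<sigma>) \<le> \<sigma> * (1 + 4 * u x) + (1 - \<sigma>)"
        using \<sigma> u[of x] exp_le_one_plus_four_times[of "u x"] by (intro add_right_mono mult_left_mono) auto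
      also have "\<dots> \<le> exp (4 * \<sigma> * u x)"
        using exp_ge_add_one_self[of "4 * \<sigma> * u x"] by (simp add: algebra_simps)
      finally show ?thesis using True by simp
    qed (use \<sigma> in simp)
  qed
  also have "\<dots> = exp (\<Sum>x\<in>A. of_bool (x \<in> L) * (4 * \<sigma> * u x))"
    by (rule exp_sum[OF fin, symmetric])
  also have "(\<Sum>x\<in>A. of_bool (x \<in> L) * (4 * \<sigma> * u x)) = (\<Sum>x\<in>L. 4 * \<sigma> * u x)"
    using fin L by (intro sum.mono_neutral_cong_right) auto
  finally show ?thesis by (simp add: sum_distrib_left)
qed

text \<open>One factor \<open>exp (U / 2)\<close> pays for the square; the other is at least
  \<open>exp (\<Lambda> / 2)\<close> on the tail.\<close>

lemma square_tail_le_exp: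
  fixes U \<Lambda> :: real
  assumes "U > \<Lambda>" "U \<ge> 0"
  shows "U\<^sup>2 \<le> 16 * exp (- \<Lambda> / 2) * exp U"
proof -
  have "U / 4 \<le> exp (U / 4)"
    using exp_ge_add_one_self[of "U/4"] by linarith
  then have "(U / 4)\<^sup>2 \<le> exp (U / 4) ^ 2"
    using assms by (intro power_mono) auto
  then have "U\<^sup>2 \<le> 16 * exp (U / 2)"
    by (simp add: power_divide flip: exp_of_nat_mult)
  also have "exp (U / 2) \<le> exp (- \<Lambda> / 2) * exp U"
    using assms by (simp flip: exp_add)
  finally show ?thesis by simp
qed

text \<open>
  Only the pair correlations \<open>P(i \<in> S \<and> a \<in> S \<and> S \<subseteq> L)\<close> enter the lower bound for the first moment
  of \<open>Z\<close>. The exponential moment of \<open>U(S) = \<mu>(S) / c + |S \<inter> B|\<close> then shows that the sets with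
  \<open>U(S) > \<Lambda>\<close> contribute little to it; on the others the normalization \<open>\<mu>(S)\<^sup>2\<close> and the number of
  elements of \<open>S \<inter> B\<close> are under control.
\<close>

lemma expected_discrepancy_lower_bound:
  fixes \<mu> d :: "'a \<Rightarrow> real" and \<sigma> c V \<Lambda> :: real and X :: "'a set \<Rightarrow> real"
  assumes fin: "finite A" and L: "L \<subseteq> A" and B: "B \<subseteq> L" and \<sigma>: "0 \<le> \<sigma>" "\<sigma> \<le> 1"
    and d: "\<And>i. i \<in> A \<Longrightarrow> \<bar>d i\<bar> \<le> \<mu> i"
    and c: "c > 0" "\<And>i. i \<in> L \<Longrightarrow> \<mu> i \<le> c"
    and rare: "\<sigma> * card (A - L) \<le> 1/2" "\<sigma> * card B \<le> 1/2" "\<sigma> * sum \<mu> L \<le> c / 4"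
    and V: "V \<ge> 0" "V \<le> (\<Sum>i\<in>B. \<bar>d i * sum \<mu> L - \<mu> i * sum d L\<bar>)"
    and \<Lambda>: "\<Lambda> > 0"
    and X: "\<And>S. S \<subseteq> A \<Longrightarrow> X S \<ge> 0"
      "\<And>S i. S \<subseteq> A \<Longrightarrow> i \<in> S \<Longrightarrow> 2 * \<bar>d i * sum \<mu> S - \<mu> i * sum d S\<bar> \<le> X S * (sum \<mu> S)\<^sup>2"
  shows "(\<sigma>\<^sup>2 * V - 64 * c\<^sup>2 * exp (3 - \<Lambda> / 2)) / (\<Lambda> ^ 3 * c\<^sup>2)
    \<le> (\<Sum>S\<in>Pow A. subset_weight \<sigma> A S * X S)"
proof -
  define w where "w = subset_weight \<sigma> A"
  define u where "u i = \<mu> i / c + of_bool (i \<in> B)" for i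
  define W where "W i S = d i * sum \<mu> S - \<mu> i * sum d S" for i S
  define Z where "Z S = (\<Sum>i\<in>S \<inter> B. \<bar>W i S\<bar>)" for S
  note w = subset_weight_nonneg[OF \<sigma>, of A, folded w_def]
  have finS: "finite S" if "S \<subseteq> A" for S using fin that finite_subset by metis
  have nonneg: "\<mu> i \<ge> 0" if "i \<in> A" for i using d[OF that] by linarith
  have u: "0 \<le> u i \<and> u i \<le> 2" if "i \<in> L" for i
  proof -
    have "0 \<le> \<mu> i / c" "\<mu> i / c \<le> 1" using nonneg[of i] c that L by auto
    then show ?thesis by (simp add: u_def)
  qed
  have sum_u: "sum u S = sum \<mu> S / c + card (S \<inter> B)" if "S \<subseteq> A" for S
    using finS[OF that] by (simp add: u_def sum.distrib sum_divide_distrib of_bool_def sum.If_cases)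
  have "\<sigma> * sum u L = \<sigma> * sum \<mu> L / c + \<sigma> * card B"
    using B sum_u[OF L] by (simp add: algebra_simps Int_absorb1)
  moreover have "\<sigma> * sum \<mu> L / c \<le> 1/4"
    using rare(3) c(1) by (simp add: divide_simps)
  ultimately have "\<sigma> * sum u L \<le> 3/4"
    using rare(2) by linarith
  then have exp_moment: "(\<Sum>S\<in>Pow A. w S * (of_bool (S \<subseteq> L) * exp (sum u S))) \<le> exp 3"
    unfolding w_def by (intro order_trans[OF sum_subset_weight_exp_le[OF fin L \<sigma>]]) (use u in auto)
  \<comment> \<open>Sets with \<open>sum u S \<le> \<Lambda>\<close> have at most
    \<open>\<Lambda>\<close> elements in \<open>B\<close> and mass at most
    \<open>c * \<Lambda>\<close>, so \<open>X S\<close> controls \<open>Z S\<close>. For the others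
    only \<open>Z S \<le> 2 * (sum \<mu> S)\<^sup>2\<close> is used, and the exponential absorbs
    it.\<close>
  have split: "of_bool (S \<subseteq> L) * Z S
      \<le> X S * (\<Lambda> ^ 3 * c\<^sup>2 / 2) + 32 * c\<^sup>2 * exp (- \<Lambda> / 2) * (of_bool (S \<subseteq> L) * exp (sum u S))"
    if "S \<subseteq> A" for S
  proof (cases "S \<subseteq> L")
    case True
    define U where "U = sum u S"
    have mS: "0 \<le> sum \<mu> S" using that nonneg by (intro sum_nonneg) auto
    have U: "U = sum \<mu> S / c + card (S \<inter> B)" unfolding U_def by (rule sum_u[OF that])
    have mU: "sum \<mu> S \<le> c * U" "card (S \<inter> B) \<le> U" "0 \<le> U"
      using mS c(1) by (auto simp: U field_simps)
    show ?thesis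
    proof (cases "U \<le> \<Lambda>")
      case True
      have "Z S \<le> (\<Sum>i\<in>S \<inter> B. X S * (sum \<mu> S)\<^sup>2 / 2)"
        unfolding Z_def W_def using X(2)[OF that] by (intro sum_mono) (auto simp: field_simps)
      also have "\<dots> = card (S \<inter> B) * (X S * (sum \<mu> S)\<^sup>2 / 2)" by simp
      also have "\<dots> \<le> \<Lambda> * (X S * (c * \<Lambda>)\<^sup>2 / 2)"
        using mU True mS X(1)[OF that] \<Lambda> c(1)
        by (intro mult_mono divide_right_mono power_mono mult_left_mono)
          (auto intro: order_trans[OF mU(1)] order_trans[OF mU(2)])
      also have "\<dots> = X S * (\<Lambda> ^ 3 * c\<^sup>2 / 2)"
        by (simp add: power2_eq_square power3_eq_cube)
      finally show ?thesis using \<open>S \<subseteq> L\<close> by (auto intro: add_increasing2)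
    next
      case False
      have "Z S \<le> (\<Sum>i\<in>S \<inter> B. 2 * \<mu> i * sum \<mu> S)"
        unfolding Z_def
      proof (intro sum_mono)
        fix i assume "i \<in> S \<inter> B"
        then have i: "i \<in> A" using that by auto
        have dS: "\<bar>sum d S\<bar> \<le> sum \<mu> S"
          using that d by (intro order_trans[OF sum_abs] sum_mono) auto
        have "\<bar>W i S\<bar> \<le> \<bar>d i * sum \<mu> S\<bar> + \<bar>\<mu> i * sum d S\<bar>"
          unfolding W_def by (rule abs_triangle_ineq4)
        also have "\<dots> = \<bar>d i\<bar> * sum \<mu> S + \<mu> i * \<bar>sum d S\<bar>"
          using mS nonneg[OF i] by (simp add: abs_mult)
        also have "\<dots> \<le> \<mu> i * sum \<mu> S + \<mu> i * sum \<mu> S"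
          using d[OF i] dS mS nonneg[OF i] by (intro add_mono mult_mono) auto
        finally show "\<bar>W i S\<bar> \<le> 2 * \<mu> i * sum \<mu> S" by simp
      qed
      also have "\<dots> \<le> (\<Sum>i\<in>S. 2 * \<mu> i * sum \<mu> S)"
        using that nonneg mS by (intro sum_mono2 finS) auto
      also have "\<dots> = 2 * (sum \<mu> S)\<^sup>2"
        by (simp add: power2_eq_square sum_distrib_left sum_distrib_right mult_ac)
      also have "\<dots> \<le> 2 * (c * U)\<^sup>2"
        using mU mS by (intro mult_left_mono power_mono) auto
      also have "\<dots> = 2 * c\<^sup>2 * U\<^sup>2" by (simp add: power_mult_distrib)
      also have "\<dots> \<le> 2 * c\<^sup>2 * (16 * exp (- \<Lambda> / 2) * exp U)"
        using False mU square_tail_le_exp[of \<Lambda> U] by (intro mult_left_mono) auto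
      finally have "Z S \<le> 32 * c\<^sup>2 * exp (- \<Lambda> / 2) * exp U" by simp
      moreover have "0 \<le> X S * (\<Lambda> ^ 3 * c\<^sup>2 / 2)" using X(1)[OF that] \<Lambda> by simp
      ultimately show ?thesis using \<open>S \<subseteq> L\<close> by (simp add: U_def)
    qed
  qed (use X(1)[OF that] \<Lambda> in simp)
  \<comment> \<open>\<open>W i S\<close> is the sum over \<open>a \<in> S\<close> of
    \<open>d i * \<mu> a - \<mu> i * d a\<close>. The term \<open>a = i\<close> vanishes and all
    other pairs have the same probability, so the expectation is a multiple of the same expression
    for \<open>L\<close>.\<close>
  have single: "(\<Sum>S\<in>Pow A. w S * of_bool (S \<subseteq> L \<and> i \<in> S) * W i S)
      = \<sigma>\<^sup>2 * (1 - \<sigma>) ^ card (A - L) * (d i * sum \<mu> L - \<mu> i * sum d L)" if i: "i \<in> B" for i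
  proof -
    have "w S * of_bool (S \<subseteq> L \<and> i \<in> S) * W i S =
        (\<Sum>a\<in>L. w S * of_bool (S \<subseteq> L \<and> i \<in> S \<and> a \<in> S) * (d i * \<mu> a - \<mu> i * d a))" for S
    proof (cases "S \<subseteq> L \<and> i \<in> S")
      case True
      have "(\<Sum>a\<in>L. w S * of_bool (S \<subseteq> L \<and> i \<in> S \<and> a \<in> S) * (d i * \<mu> a - \<mu> i * d a)) =
          (\<Sum>a\<in>S. w S * (d i * \<mu> a - \<mu> i * d a))"
        using True finS[OF L] by (intro sum.mono_neutral_cong_right) auto
      then show ?thesis using True
        by (simp add: W_def sum_distrib_left sum_subtractf flip: sum_distrib_left)
    next
      case False
      then show ?thesis by (subst sum.neutral) auto
    qed
    then have "(\<Sum>S\<in>Pow A. w S * of_bool (S \<subseteq> L \<and> i \<in> S) * W i S) =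
        (\<Sum>a\<in>L. (\<Sum>S\<in>Pow A. w S * of_bool (S \<subseteq> L \<and> i \<in> S \<and> a \<in> S)) * (d i * \<mu> a - \<mu> i * d a))"
      by (simp add: sum.swap[of _ "Pow A" L] sum_distrib_right)
    also have "\<dots> = (\<Sum>a\<in>L. \<sigma>\<^sup>2 * (1 - \<sigma>) ^ card (A - L) * (d i * \<mu> a - \<mu> i * d a))"
    proof (intro sum.cong refl)
      fix a assume a: "a \<in> L"
      show "(\<Sum>S\<in>Pow A. w S * of_bool (S \<subseteq> L \<and> i \<in> S \<and> a \<in> S)) * (d i * \<mu> a - \<mu> i * d a)
          = \<sigma>\<^sup>2 * (1 - \<sigma>) ^ card (A - L) * (d i * \<mu> a - \<mu> i * d a)"
      proof (cases "a = i")
        case False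
        then show ?thesis
          using sum_subset_weight_pair[OF fin L, of i a \<sigma>] i B a by (auto simp: w_def)
      qed simp
    qed
    finally show ?thesis
      by (simp add: sum_distrib_left sum_subtractf flip: sum_distrib_left)
  qed
  have "1/2 \<le> 1 + real (card (A - L)) * (- \<sigma>)" using rare(1) by (simp add: mult.commute)
  also have "\<dots> \<le> (1 + - \<sigma>) ^ card (A - L)" using \<sigma> by (intro Bernoulli_inequality) auto
  finally have half: "1/2 \<le> (1 - \<sigma>) ^ card (A - L)" by simp
  \<comment> \<open>The signed expectations are known exactly by \<open>single\<close>; by the
    triangle inequality their absolute values bound the expectation of
    \<open>\<bar>W i S\<bar>\<close> from below.\<close>
  have "\<sigma>\<^sup>2 * (1/2) * V \<le> \<sigma>\<^sup>2 * (1 - \<sigma>) ^ card (A - L) * (\<Sum>i\<in>B. \<bar>d i * sum \<mu> L - \<mu> i * sum d L\<bar>)"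
    using half V \<sigma> by (intro mult_mono) auto
  also have "\<dots> = (\<Sum>i\<in>B. \<bar>\<sigma>\<^sup>2 * (1 - \<sigma>) ^ card (A - L) * (d i * sum \<mu> L - \<mu> i * sum d L)\<bar>)"
    using \<sigma> by (simp add: sum_distrib_left abs_mult)
  also have "\<dots> = (\<Sum>i\<in>B. \<bar>\<Sum>S\<in>Pow A. w S * of_bool (S \<subseteq> L \<and> i \<in> S) * W i S\<bar>)"
    by (intro sum.cong) (simp_all add: single)
  also have "\<dots> \<le> (\<Sum>i\<in>B. \<Sum>S\<in>Pow A. w S * of_bool (S \<subseteq> L \<and> i \<in> S) * \<bar>W i S\<bar>)"
    by (intro sum_mono order_trans[OF sum_abs]) (auto simp: abs_mult w)
  also have "\<dots> = (\<Sum>S\<in>Pow A. \<Sum>i\<in>B. w S * of_bool (S \<subseteq> L \<and> i \<in> S) * \<bar>W i S\<bar>)"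
    by (rule sum.swap)
  also have "\<dots> = (\<Sum>S\<in>Pow A. w S * (of_bool (S \<subseteq> L) * Z S))"
  proof (intro sum.cong refl)
    fix S
    have "(\<Sum>i\<in>B. w S * of_bool (S \<subseteq> L \<and> i \<in> S) * \<bar>W i S\<bar>)
        = (\<Sum>i\<in>S \<inter> B. w S * of_bool (S \<subseteq> L) * \<bar>W i S\<bar>)"
      using finS[of B] B L by (intro sum.mono_neutral_cong_right) auto
    then show "(\<Sum>i\<in>B. w S * of_bool (S \<subseteq> L \<and> i \<in> S) * \<bar>W i S\<bar>) = w S * (of_bool (S \<subseteq> L) * Z S)"
      by (simp add: Z_def sum_distrib_left mult.assoc)
  qed
  also have "\<dots> \<le> (\<Sum>S\<in>Pow A. w S * (X S * (\<Lambda> ^ 3 * c\<^sup>2 / 2)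
      + 32 * c\<^sup>2 * exp (- \<Lambda> / 2) * (of_bool (S \<subseteq> L) * exp (sum u S))))"
    using split w by (intro sum_mono mult_left_mono) auto
  also have "\<dots> = (\<Sum>S\<in>Pow A. w S * X S) * (\<Lambda> ^ 3 * c\<^sup>2 / 2)
      + 32 * c\<^sup>2 * exp (- \<Lambda> / 2) * (\<Sum>S\<in>Pow A. w S * (of_bool (S \<subseteq> L) * exp (sum u S)))"
    by (simp add: sum_distrib_left sum_distrib_right sum.distrib algebra_simps)
  also have "\<dots> \<le> (\<Sum>S\<in>Pow A. w S * X S) * (\<Lambda> ^ 3 * c\<^sup>2 / 2) + 32 * c\<^sup>2 * exp (- \<Lambda> / 2) * exp 3"
    using exp_moment by (intro add_left_mono mult_left_mono) auto
  also have "32 * c\<^sup>2 * exp (- \<Lambda> / 2) * exp 3 = 32 * c\<^sup>2 * exp (3 - \<Lambda> / 2)"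
    by (simp add: mult.assoc flip: exp_add)
  finally show ?thesis
    using \<Lambda> c(1) by (simp add: w_def field_simps)
qed

section \<open>Discrepancy of the conditional distributions\<close>

lemma pmf_cond_oracle:
  assumes "measure_pmf.prob p S \<noteq> 0" "i \<in> S"
  shows "pmf (cond_oracle p S) i = pmf p i / measure_pmf.prob p S"
proof -
  have "set_pmf p \<inter> S \<noteq> {}"
    using assms(1) by (auto simp: measure_pmf_zero_iff)
  then show ?thesis
    using assms by (simp add: cond_oracle_def pmf_cond)
qed

text \<open>The maximum runs over \<open>{1..n}\<close> instead of \<open>S\<close>, so for
  \<open>n \<ge> 1\<close> it also makes sense for \<open>S = {}\<close>: both oracles then fall
  back to the same \<open>pmf_of_set\<close>, and the value is \<open>0\<close>.\<close>

definition discrepancy :: "nat \<Rightarrow> nat pmf \<Rightarrow> nat pmf \<Rightarrow> nat set \<Rightarrow> real" where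
  "discrepancy n p q S = Max ((\<lambda>i. \<bar>pmf (cond_oracle p S) i - pmf (cond_oracle q S) i\<bar>) ` {1..n})"

lemma discrepancy_ge:
  "i \<in> {1..n} \<Longrightarrow> \<bar>pmf (cond_oracle p S) i - pmf (cond_oracle q S) i\<bar> \<le> discrepancy n p q S"
  unfolding discrepancy_def by (rule Max_ge) auto

lemma discrepancy_attained:
  assumes "n \<ge> 1"
  shows "\<exists>i\<in>{1..n}. discrepancy n p q S = \<bar>pmf (cond_oracle p S) i - pmf (cond_oracle q S) i\<bar>"
proof -
  have "discrepancy n p q S \<in> (\<lambda>i. \<bar>pmf (cond_oracle p S) i - pmf (cond_oracle q S) i\<bar>) ` {1..n}"
    unfolding discrepancy_def using assms by (intro Max_in) auto
  then show ?thesis by blast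
qed

lemma discrepancy_bounds:
  assumes "n \<ge> 1"
  shows "0 \<le> discrepancy n p q S" "discrepancy n p q S \<le> 1"
proof -
  obtain i where i: "discrepancy n p q S = \<bar>pmf (cond_oracle p S) i - pmf (cond_oracle q S) i\<bar>"
    using discrepancy_attained[OF assms] by blast
  show "0 \<le> discrepancy n p q S" by (simp add: i)
  show "discrepancy n p q S \<le> 1"
    using pmf_nonneg[of "cond_oracle p S" i] pmf_le_1[of "cond_oracle p S" i]
      pmf_nonneg[of "cond_oracle q S" i] pmf_le_1[of "cond_oracle q S" i]
    unfolding i by linarith
qed

text \<open>If \<open>P\<close> and \<open>Q\<close> are the masses of \<open>S\<close>, the
  left-hand side is \<open>\<bar>pmf p i * Q - pmf q i * P\<bar>\<close>; for positive masses this
  is \<open>P * Q\<close> times the difference of the conditional probabilities. Finally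
  \<open>P * Q \<le> (sum \<mu> S)\<^sup>2\<close> by the arithmetic-geometric mean
  inequality.\<close>

lemma cross_difference_le_discrepancy:
  fixes p q :: "nat pmf"
  defines "\<mu> \<equiv> \<lambda>i. (pmf p i + pmf q i) / 2" and "d \<equiv> \<lambda>i. (pmf p i - pmf q i) / 2"
  assumes S: "S \<subseteq> {1..n}" and i: "i \<in> S"
  shows "2 * \<bar>d i * sum \<mu> S - \<mu> i * sum d S\<bar> \<le> discrepancy n p q S * (sum \<mu> S)\<^sup>2"
proof -
  have fin: "finite S" using S finite_subset by blast
  define P where "P = measure_pmf.prob p S"
  define Q where "Q = measure_pmf.prob q S"
  have PQ: "P = sum (pmf p) S" "Q = sum (pmf q) S"
    using fin by (simp_all add: P_def Q_def measure_measure_pmf_finite)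
  have mu: "sum \<mu> S = (P + Q) / 2" and d: "sum d S = (P - Q) / 2"
    by (simp_all add: \<mu>_def d_def PQ sum.distrib sum_subtractf flip: sum_divide_distrib)
  have eq: "2 * (d i * sum \<mu> S - \<mu> i * sum d S) = pmf p i * Q - pmf q i * P"
    unfolding mu d by (simp add: \<mu>_def d_def field_simps)
  have "\<bar>pmf p i * Q - pmf q i * P\<bar> \<le> discrepancy n p q S * (P * Q)"
  proof (cases "P = 0 \<or> Q = 0")
    \<comment> \<open>if one mass vanishes, the oracle is uniform and carries no information, but the left-hand side is \<open>0\<close>\<close>
    case True
    have "pmf p i \<le> P" "pmf q i \<le> Q"
      using i fin by (auto simp: PQ intro!: member_le_sum)
    then have "pmf p i * Q - pmf q i * P = 0"
      using True pmf_nonneg[of p i] pmf_nonneg[of q i] by auto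
    then show ?thesis using True by auto
  next
    case False
    then have pos: "P > 0" "Q > 0"
      by (auto simp: P_def Q_def zero_less_measure_iff)
    have "\<bar>pmf p i / P - pmf q i / Q\<bar> \<le> discrepancy n p q S"
      using discrepancy_ge[of i n p S q] i S False by (auto simp: pmf_cond_oracle P_def Q_def)
    then have "\<bar>pmf p i / P - pmf q i / Q\<bar> * (P * Q) \<le> discrepancy n p q S * (P * Q)"
      using pos by (intro mult_right_mono) auto
    moreover have "\<bar>pmf p i / P - pmf q i / Q\<bar> * (P * Q) = \<bar>(pmf p i / P - pmf q i / Q) * (P * Q)\<bar>"
      using pos by (simp add: abs_mult)
    moreover have "(pmf p i / P - pmf q i / Q) * (P * Q) = pmf p i * Q - pmf q i * P"
      using pos by (simp add: field_simps)
    ultimately show ?thesis by simp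
  qed
  also have "\<dots> \<le> discrepancy n p q S * ((P + Q) / 2)\<^sup>2"
  proof (intro mult_left_mono)
    have "(P - Q)\<^sup>2 \<ge> 0" by simp
    then show "P * Q \<le> ((P + Q) / 2)\<^sup>2" by (simp add: power2_eq_square field_simps)
    show "0 \<le> discrepancy n p q S"
      using discrepancy_bounds(1)[of n p q S] S i by auto
  qed
  finally have "\<bar>2 * (d i * sum \<mu> S - \<mu> i * sum d S)\<bar> \<le> discrepancy n p q S * (sum \<mu> S)\<^sup>2"
    unfolding eq by (simp only: mu)
  then show ?thesis by (simp only: abs_mult abs_numeral)
qed

text \<open>Reduces an unknown ideal density to \<open>N + 1\<close> candidates at the cost of a
  factor two, so that it can be guessed.\<close>

lemma exists_dyadic_in_half_interval:
  fixes x :: real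
  assumes "(1/2) ^ N \<le> x" "x \<le> 1"
  shows "\<exists>j\<le>N. x / 2 \<le> (1/2) ^ j \<and> (1/2) ^ j \<le> x"
proof -
  define j where "j = (LEAST j. (1/2) ^ j \<le> x)"
  have j: "(1/2) ^ j \<le> x" "j \<le> N"
    unfolding j_def using assms(1) by (auto intro: LeastI Least_le)
  have "x / 2 \<le> (1/2) ^ j"
  proof (cases j)
    case (Suc k)
    then have "\<not> (1/2) ^ k \<le> x"
      using not_less_Least[of k "\<lambda>j. (1/2) ^ j \<le> x"] by (simp add: j_def)
    then show ?thesis using Suc by simp
  qed (use assms in simp)
  with j show ?thesis by blast
qed

lemma card_le_of_sum_ge:
  fixes \<mu> :: "'a \<Rightarrow> real"
  assumes "finite B" "c > 0" "\<And>i. i \<in> B \<Longrightarrow> c \<le> \<mu> i"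
  shows "card B \<le> sum \<mu> B / c"
proof -
  have "card B * c \<le> sum \<mu> B"
    using sum_bounded_below[of B c \<mu>] assms by (simp add: mult.commute)
  then show ?thesis using assms(2) by (simp add: field_simps)
qed

text \<open>The factor \<open>(real J + 1)\<^sup>2\<close> is lost twice: in \<open>D\<close>, for
  sharing the distance among the buckets, and in \<open>K\<^sup>2\<close>, for thinning the random
  set until it avoids the heavy elements.\<close>

lemma expected_discrepancy_at_some_rate:
  fixes p q :: "nat pmf" and \<epsilon> \<Lambda> :: real and n J :: nat
  assumes n: "n \<ge> 1" and dist: "is_dist_on n p" "is_dist_on n q" and \<epsilon>: "0 < \<epsilon>"
    and far: "d_TV n p q \<ge> \<epsilon>" and J: "n * (1/2) ^ Suc J \<le> \<epsilon> / 2"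
    and \<Lambda>: "\<Lambda> > 0" "exp (3 - \<Lambda> / 2) \<le> \<epsilon> / (32768 * (real J + 1) ^ 4)"
  shows "\<exists>j\<le>5 * J + 4. \<epsilon> / (512 * (real J + 1) ^ 4 * \<Lambda> ^ 3)
    \<le> (\<Sum>S\<in>Pow {1..n}. subset_weight ((1/2) ^ j) {1..n} S * discrepancy n p q S)"
proof -
  define A where "A = {1..n}"
  define \<mu> where "\<mu> i = (pmf p i + pmf q i) / 2" for i
  define d where "d i = (pmf p i - pmf q i) / 2" for i
  \<comment> \<open>The buckets account for \<open>\<epsilon> / 4\<close> and the tail for at most
    \<open>\<epsilon> / 2\<close>, which together stay strictly below the distance.\<close>
  define D where "D = \<epsilon> / (4 * (real J + 1)\<^sup>2)"
  \<comment> \<open>There will be at most \<open>2 * t / \<rho>\<close> heavy elements, so at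
    density at most \<open>\<rho> / K\<close> at most \<open>2 * t / K \<le> 1/2\<close> of them are
    expected in the set.\<close>
  define K where "K = 4 * (real J + 1)"
  define M where "M l = sum \<mu> (light \<mu> A l)" for l
  have fin: "finite A" by (simp add: A_def)
  have finL: "finite (light \<mu> A l)" for l
    using fin light_subset finite_subset by metis
  have total: "sum (pmf p) A = 1" "sum (pmf q) A = 1"
    using dist by (auto simp: A_def is_dist_on_def intro: sum_pmf_eq_1)
  have d_le: "\<bar>d i\<bar> \<le> \<mu> i" for i
    using pmf_nonneg[of p i] pmf_nonneg[of q i] by (auto simp: d_def \<mu>_def abs_le_iff)
  have mu_nonneg: "\<mu> i \<ge> 0" for i by (simp add: \<mu>_def)
  have one: "sum \<mu> A = 1" and zero: "sum d A = 0"
    using total by (simp_all add: \<mu>_def d_def sum.distrib sum_subtractf flip: sum_divide_distrib)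
  have D_pos: "D > 0" using \<epsilon> by (simp add: D_def)
  have "sum \<mu> (light \<mu> A (Suc J)) \<le> card (light \<mu> A (Suc J)) * (1/2) ^ Suc J"
    by (rule sum_bounded_above) (simp add: light_def)
  also have "\<dots> \<le> n * (1/2) ^ Suc J"
    using card_mono[OF fin light_subset] by (intro mult_right_mono) (auto simp: A_def)
  also have "\<dots> \<le> \<epsilon> / 2" by (rule J)
  finally have tail: "sum \<mu> (light \<mu> A (Suc J)) \<le> \<epsilon> / 2" .
  have "D * (real J + 1)\<^sup>2 = \<epsilon> / 4" by (simp add: D_def)
  moreover have "(\<Sum>i\<in>A. \<bar>d i\<bar>) = d_TV n p q"
    by (simp add: d_TV_def d_def A_def abs_divide sum_distrib_left)
  ultimately have far': "(\<Sum>i\<in>A. \<bar>d i\<bar>) > D * (real J + 1)\<^sup>2 + sum \<mu> (light \<mu> A (Suc J))"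
    using tail far \<epsilon> by linarith
  obtain t l where tl: "t \<le> l" "l \<le> J" "M t > 0"
    and ratio: "\<And>k. k \<le> l \<Longrightarrow> (1/2) ^ t * M k \<le> (1/2) ^ k * M t"
    and bucket: "(\<Sum>i\<in>bucket \<mu> A l. \<bar>d i * M t - \<mu> i * sum d (light \<mu> A t)\<bar>) > D * (M t)\<^sup>2"
    using exists_discrepant_bucket[OF fin d_le one zero _ far'] D_pos unfolding M_def by force
  define c :: real where "c = (1/2) ^ t"
  define \<rho> where "\<rho> = c / M t"
  define L where "L = light \<mu> A t"
  define B where "B = bucket \<mu> A l"
  have c_pos: "c > 0" by (simp add: c_def)
  have \<rho>_pos: "\<rho> > 0" using c_pos tl(3) by (simp add: \<rho>_def)
  have K: "K \<ge> 4" "K > 0" by (simp_all add: K_def)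
  have Mt: "M t \<le> 1"
    using sum_mono2[OF fin light_subset[of \<mu> A t], of \<mu>] mu_nonneg one by (simp add: M_def)
  have "\<mu> i \<le> 1" if "i \<in> A" for i
    using member_le_sum[OF that, of \<mu>] mu_nonneg fin one by auto
  then have "light \<mu> A 0 = A" by (auto simp: light_def)
  then have "c \<le> M t" using ratio[of 0] one by (simp add: M_def c_def)
  then have \<rho>_le: "\<rho> \<le> 1" using tl(3) by (simp add: \<rho>_def)
  \<comment> \<open>Elements of bucket \<open>k\<close> are heavier than
    \<open>(1/2) ^ Suc k\<close>, so there are at most \<open>2 ^ Suc k * M k\<close> of them;
    minimality of the ratio makes this bound independent of \<open>k\<close>.\<close>
  have bucket_card: "card (bucket \<mu> A k) \<le> 2 / \<rho>" if "k \<le> l" for k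
  proof -
    have sub: "bucket \<mu> A k \<subseteq> light \<mu> A k" by (rule bucket_subset_light)
    have "card (bucket \<mu> A k) \<le> sum \<mu> (bucket \<mu> A k) / (1/2) ^ Suc k"
      using finite_subset[OF sub finL] by (intro card_le_of_sum_ge) (auto simp: bucket_def light_def)
    also have "\<dots> \<le> M k / (1/2) ^ Suc k"
      unfolding M_def using mu_nonneg by (intro divide_right_mono sum_mono2[OF finL sub]) auto
    also have "\<dots> \<le> 2 / \<rho>"
      using ratio[OF that] tl(3) by (simp add: \<rho>_def c_def divide_simps mult_ac)
    finally show ?thesis .
  qed
  have "A - light \<mu> A t = (\<Union>k\<in>{0..<t}. bucket \<mu> A k)" for t
  proof (induction t)
    case (Suc t)
    have "A - light \<mu> A (Suc t) = (A - light \<mu> A t) \<union> bucket \<mu> A t"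
      using light_subset[of \<mu> A t] light_Suc_subset[of \<mu> A t] by (auto simp: bucket_def)
    then show ?case using Suc by (simp add: atLeastLessThanSuc Un_commute)
  qed (simp add: \<open>light \<mu> A 0 = A\<close>)
  then have "A - L = (\<Union>k\<in>{0..<t}. bucket \<mu> A k)" by (simp add: L_def)
  then have "real (card (A - L)) \<le> (\<Sum>k\<in>{0..<t}. real (card (bucket \<mu> A k)))"
    using card_UN_le[of "{0..<t}" "bucket \<mu> A"] by (simp flip: of_nat_sum)
  also have "\<dots> \<le> (\<Sum>k\<in>{0..<t}. 2 / \<rho>)"
    using bucket_card tl(1) by (intro sum_mono) auto
  also have "\<dots> = t * (2 / \<rho>)" by simp
  finally have card_H: "card (A - L) \<le> t * (2 / \<rho>)" .
  \<comment> \<open>In the range \<open>5 * J + 4\<close> for \<open>j\<close>, one \<open>J\<close>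
    comes from \<open>\<rho> \<ge> (1/2) ^ J\<close> and the rest from this crude bound on
    \<open>K\<close>.\<close>
  have "K \<le> 2 ^ (4 * (J + 1))"
    using of_nat_less_two_power[of "4 * (J + 1)", where 'a = real] by (simp add: K_def)
  then have "(1/2) ^ (4 * (J + 1)) \<le> 1 / K"
    using K by (simp add: power_one_over field_simps)
  moreover have "(1/2) ^ J \<le> \<rho>"
  proof -
    have "(1/2) ^ J \<le> c" unfolding c_def using tl by (intro power_decreasing) auto
    also have "c \<le> \<rho>" using Mt tl(3) c_pos by (simp add: \<rho>_def field_simps)
    finally show ?thesis .
  qed
  ultimately have "(1/2) ^ (4 * (J + 1)) * (1/2) ^ J \<le> 1 / K * \<rho>"
    using K by (intro mult_mono) auto
  then have "(1/2) ^ (5 * J + 4) \<le> \<rho> / K"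
    by (simp add: algebra_simps flip: power_add)
  moreover have "\<rho> / K \<le> 1" using \<rho>_le K by (simp add: field_simps)
  ultimately obtain j where j: "j \<le> 5 * J + 4" "\<rho> / K / 2 \<le> (1/2) ^ j" "(1/2) ^ j \<le> \<rho> / K"
    using exists_dyadic_in_half_interval by blast
  define \<sigma> :: real where "\<sigma> = (1/2) ^ j"
  have \<sigma>: "0 \<le> \<sigma>" "\<sigma> \<le> 1" by (simp_all add: \<sigma>_def power_le_one)
  have "\<sigma> * card (A - L) \<le> \<rho> / K * (t * (2 / \<rho>))"
    using card_H j(3) \<rho>_pos K by (intro mult_mono) (auto simp: \<sigma>_def)
  also have "\<dots> \<le> 1/2" using \<rho>_pos tl by (simp add: K_def field_simps)
  finally have rare1: "\<sigma> * card (A - L) \<le> 1/2" .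
  have "\<sigma> * card B \<le> \<rho> / K * (2 / \<rho>)"
    using bucket_card[of l] j(3) \<rho>_pos K by (intro mult_mono) (auto simp: \<sigma>_def B_def)
  also have "\<dots> \<le> 1/2" using \<rho>_pos K by (simp add: field_simps)
  finally have rare2: "\<sigma> * card B \<le> 1/2" .
  have "\<sigma> * sum \<mu> L \<le> \<rho> / K * M t"
    unfolding \<sigma>_def L_def M_def[symmetric] using j(3) tl(3) by (intro mult_right_mono) auto
  also have "\<dots> = c / K" using tl(3) by (simp add: \<rho>_def)
  also have "\<dots> \<le> c / 4" using K c_pos by (simp add: field_simps)
  finally have rare3: "\<sigma> * sum \<mu> L \<le> c / 4" .
  define E where "E = (\<Sum>S\<in>Pow A. subset_weight \<sigma> A S * discrepancy n p q S)"
  have main: "(\<sigma>\<^sup>2 * (D * (M t)\<^sup>2) - 64 * c\<^sup>2 * exp (3 - \<Lambda> / 2)) / (\<Lambda> ^ 3 * c\<^sup>2) \<le> E"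
    unfolding E_def
  proof (rule expected_discrepancy_lower_bound[where \<mu> = \<mu> and d = d and L = L and B = B])
    show "finite A" "L \<subseteq> A" "0 \<le> \<sigma>" "\<sigma> \<le> 1" "c > 0" "\<Lambda> > 0"
      using fin \<sigma> c_pos \<Lambda> by (auto simp: L_def light_def)
    show "B \<subseteq> L"
      unfolding B_def L_def using bucket_subset_light light_antimono[OF tl(1)] by (rule order_trans)
    show "\<mu> i \<le> c" if "i \<in> L" for i using that by (simp add: L_def light_def c_def)
    show "D * (M t)\<^sup>2 \<le> (\<Sum>i\<in>B. \<bar>d i * sum \<mu> L - \<mu> i * sum d L\<bar>)"
      using bucket by (simp add: L_def B_def M_def)
    show "0 \<le> discrepancy n p q S" for S using discrepancy_bounds[OF n] by blast
    show "2 * \<bar>d i * sum \<mu> S - \<mu> i * sum d S\<bar> \<le> discrepancy n p q S * (sum \<mu> S)\<^sup>2"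
      if "S \<subseteq> A" "i \<in> S" for S i
      using cross_difference_le_discrepancy[of S n i p q] that by (simp add: A_def \<mu>_def[abs_def] d_def[abs_def])
  qed (use d_le rare1 rare2 rare3 D_pos in auto)
  have "e / (4 * x\<^sup>2) / (8 * (4 * x)\<^sup>2) = e / (512 * x ^ 4)" for e x :: real
    by (simp add: power_mult_distrib power2_eq_square power4_eq_xxxx)
  then have DK: "D / (8 * K\<^sup>2) = \<epsilon> / (512 * (real J + 1) ^ 4)"
    unfolding D_def K_def .
  have "c / (2 * K) = \<rho> / K / 2 * M t" using tl(3) by (simp add: \<rho>_def)
  also have "\<dots> \<le> \<sigma> * M t" unfolding \<sigma>_def using j(2) tl(3) by (intro mult_right_mono) auto
  finally have "(c / (2 * K))\<^sup>2 \<le> (\<sigma> * M t)\<^sup>2" using c_pos K by (intro power_mono) auto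
  \<comment> \<open>The main term is at least \<open>c\<^sup>2 * (D / (4 * K\<^sup>2))\<close>. As
    \<open>32768 = 64 * 512\<close>, the hypothesis on \<open>\<Lambda>\<close> makes the tail at
    most half of that.\<close>
  then have "c\<^sup>2 * (D / (4 * K\<^sup>2)) \<le> \<sigma>\<^sup>2 * (D * (M t)\<^sup>2)"
    using mult_left_mono[of "(c / (2 * K))\<^sup>2" "(\<sigma> * M t)\<^sup>2" D] D_pos
    by (simp add: power_divide power_mult_distrib mult_ac)
  moreover have "64 * c\<^sup>2 * exp (3 - \<Lambda> / 2) \<le> 64 * c\<^sup>2 * (\<epsilon> / (32768 * (real J + 1) ^ 4))"
    using \<Lambda>(2) by (intro mult_left_mono) auto
  moreover have "64 * c\<^sup>2 * (\<epsilon> / (32768 * (real J + 1) ^ 4)) = c\<^sup>2 * (D / (8 * K\<^sup>2))"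
    unfolding DK by simp
  moreover have "c\<^sup>2 * (D / (4 * K\<^sup>2)) - c\<^sup>2 * (D / (8 * K\<^sup>2)) = c\<^sup>2 * (D / (8 * K\<^sup>2))"
    using K by (simp add: field_simps)
  ultimately have "c\<^sup>2 * (D / (8 * K\<^sup>2)) \<le> \<sigma>\<^sup>2 * (D * (M t)\<^sup>2) - 64 * c\<^sup>2 * exp (3 - \<Lambda> / 2)"
    by linarith
  then have "c\<^sup>2 * (D / (8 * K\<^sup>2)) / (\<Lambda> ^ 3 * c\<^sup>2) \<le> E"
    using \<Lambda>(1) by (intro order_trans[OF divide_right_mono main]) auto
  moreover have "c\<^sup>2 * (D / (8 * K\<^sup>2)) / (\<Lambda> ^ 3 * c\<^sup>2) = \<epsilon> / (512 * (real J + 1) ^ 4 * \<Lambda> ^ 3)"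
    unfolding DK using c_pos by simp
  ultimately show ?thesis
    using j(1) by (auto simp: E_def \<sigma>_def A_def)
qed

section \<open>Random query sets and the likely level of their discrepancy\<close>

definition random_subset :: "real \<Rightarrow> 'a set \<Rightarrow> 'a set pmf" where
  "random_subset \<sigma> A = map_pmf Collect (Pi_pmf A False (\<lambda>_. bernoulli_pmf \<sigma>))"

lemma set_random_subset: "finite A \<Longrightarrow> set_pmf (random_subset \<sigma> A) \<subseteq> Pow A"
  using set_Pi_pmf_subset[of A False "\<lambda>_. bernoulli_pmf \<sigma>"] by (auto simp: random_subset_def)

lemma pmf_random_subset:
  assumes A: "finite A" and S: "S \<subseteq> A" and \<sigma>: "0 \<le> \<sigma>" "\<sigma> \<le> 1"
  shows "pmf (random_subset \<sigma> A) S = subset_weight \<sigma> A S"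
proof -
  have "pmf (random_subset \<sigma> A) (Collect (\<lambda>x. x \<in> S)) = pmf (Pi_pmf A False (\<lambda>_. bernoulli_pmf \<sigma>)) (\<lambda>x. x \<in> S)"
    unfolding random_subset_def by (rule pmf_map_inj') (auto intro: injI)
  also have "\<dots> = (\<Prod>x\<in>A. pmf (bernoulli_pmf \<sigma>) (x \<in> S))"
    using A S by (intro pmf_Pi') auto
  also have "\<dots> = (\<Prod>x\<in>A - S. pmf (bernoulli_pmf \<sigma>) (x \<in> S)) * (\<Prod>x\<in>S. pmf (bernoulli_pmf \<sigma>) (x \<in> S))"
    by (rule prod.subset_diff[OF S A])
  also have "(\<Prod>x\<in>A - S. pmf (bernoulli_pmf \<sigma>) (x \<in> S)) = (\<Prod>x\<in>A - S. 1 - \<sigma>)"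
    using \<sigma> by (intro prod.cong) auto
  also have "(\<Prod>x\<in>S. pmf (bernoulli_pmf \<sigma>) (x \<in> S)) = (\<Prod>x\<in>S. \<sigma>)"
    using \<sigma> by (intro prod.cong) auto
  finally show ?thesis by (simp add: subset_weight_def)
qed

lemma expectation_random_subset:
  fixes f :: "'a set \<Rightarrow> real"
  assumes "finite A" "0 \<le> \<sigma>" "\<sigma> \<le> 1"
  shows "measure_pmf.expectation (random_subset \<sigma> A) f = (\<Sum>S\<in>Pow A. subset_weight \<sigma> A S * f S)"
proof -
  have "measure_pmf.expectation (random_subset \<sigma> A) f = (\<Sum>S\<in>Pow A. f S * pmf (random_subset \<sigma> A) S)"
    using assms(1) set_random_subset[OF assms(1), of \<sigma>] by (intro integral_measure_pmf_real) auto
  also have "\<dots> = (\<Sum>S\<in>Pow A. subset_weight \<sigma> A S * f S)"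
    using assms by (intro sum.cong) (auto simp: pmf_random_subset)
  finally show ?thesis .
qed

text \<open>The density is guessed uniformly. Since queries must be nonempty, \<open>{}\<close> is
  replaced by \<open>{1..n}\<close>; this cannot lower the expected discrepancy, which is
  \<open>0\<close> at \<open>{}\<close>.\<close>

definition query_set :: "nat \<Rightarrow> nat \<Rightarrow> nat set pmf" where
  "query_set n m = bind_pmf (pmf_of_set {..m}) (\<lambda>j.
     map_pmf (\<lambda>S. if S = {} then {1..n} else S) (random_subset ((1/2) ^ j) {1..n}))"

lemma set_query_set:
  assumes "n \<ge> 1" "S \<in> set_pmf (query_set n m)"
  shows "S \<noteq> {}" "S \<subseteq> {1..n}"
proof -
  obtain j S' where S': "S' \<in> set_pmf (random_subset ((1/2) ^ j) {1..n})"
    "S = (if S' = {} then {1..n} else S')"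
    using assms(2) unfolding query_set_def set_bind_pmf set_map_pmf by blast
  have "S' \<subseteq> {1..n}"
    using S'(1) set_random_subset[of "{1..n}"] by blast
  then show "S \<noteq> {}" "S \<subseteq> {1..n}"
    using S'(2) assms(1) by auto
qed

lemma expectation_query_set_ge:
  fixes f :: "nat set \<Rightarrow> real"
  assumes f: "\<And>S. 0 \<le> f S" "f {} \<le> f {1..n}" and j: "j \<le> m"
    and e: "e \<le> (\<Sum>S\<in>Pow {1..n}. subset_weight ((1/2) ^ j) {1..n} S * f S)"
  shows "e / (real m + 1) \<le> measure_pmf.expectation (query_set n m) f"
proof -
  define g where "g S = f (if S = {} then {1..n} else S)" for S
  have g: "0 \<le> g S" "f S \<le> g S" for S
    using f by (auto simp: g_def)
  have fin: "finite (set_pmf (random_subset ((1/2) ^ k) {1..n}))" for k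
    by (rule finite_subset[OF set_random_subset]) simp_all
  have int: "integrable (random_subset ((1/2) ^ k) {1..n}) h" for k and h :: "nat set \<Rightarrow> real"
    by (rule integrable_measure_pmf_finite[OF fin])
  have "measure_pmf.expectation (query_set n m) f =
      (\<Sum>k\<le>m. measure_pmf.expectation (random_subset ((1/2) ^ k) {1..n}) g /\<^sub>R real (card {..m}))"
    unfolding query_set_def g_def using fin
    by (subst pmf_expectation_bind_pmf_of_set) simp_all
  also have "\<dots> = (\<Sum>k\<le>m. measure_pmf.expectation (random_subset ((1/2) ^ k) {1..n}) g) / (real m + 1)"
    unfolding real_scaleR_def sum_distrib_left[symmetric] divide_inverse card_atMost of_nat_Suc
    by (simp only: mult.commute add.commute)
  finally have eq: "measure_pmf.expectation (query_set n m) f =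
    (\<Sum>k\<le>m. measure_pmf.expectation (random_subset ((1/2) ^ k) {1..n}) g) / (real m + 1)" .
  have "e \<le> measure_pmf.expectation (random_subset ((1/2) ^ j) {1..n}) f"
    using e by (simp add: expectation_random_subset power_le_one)
  also have "\<dots> \<le> measure_pmf.expectation (random_subset ((1/2) ^ j) {1..n}) g"
    by (intro integral_mono int g)
  also have "\<dots> \<le> (\<Sum>k\<le>m. measure_pmf.expectation (random_subset ((1/2) ^ k) {1..n}) g)"
    using j by (intro member_le_sum Bochner_Integration.integral_nonneg g) simp_all
  finally have "e \<le> (\<Sum>k\<le>m. measure_pmf.expectation (random_subset ((1/2) ^ k) {1..n}) g)" .
  then show ?thesis unfolding eq by (rule divide_right_mono) simp
qed

text \<open>A value between \<open>(1/2) ^ Suc t\<close> and \<open>(1/2) ^ t\<close> is paid for by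
  layer \<open>t\<close> alone; values below all layers are at most
  \<open>(1/2) ^ T\<close>.\<close>

lemma dyadic_layer_le:
  fixes x :: real
  assumes "0 \<le> x" "x \<le> 1"
  shows "x \<le> (1/2) ^ T + (\<Sum>t<T. (1/2) ^ t * of_bool (x \<ge> (1/2) ^ Suc t))"
proof (induction T)
  case (Suc T)
  show ?case
  proof (cases "x \<ge> (1/2) ^ Suc T")
    case True
    then have "(\<Sum>t<Suc T. (1/2 :: real) ^ t * of_bool (x \<ge> (1/2) ^ Suc t)) =
        (\<Sum>t<T. (1/2) ^ t * of_bool (x \<ge> (1/2) ^ Suc t)) + (1/2) ^ T" by simp
    then show ?thesis using Suc zero_le_power[of "1/2 :: real" "Suc T"] by linarith
  next
    case False
    have "0 \<le> (\<Sum>t<Suc T. (1/2) ^ t * of_bool (x \<ge> (1/2) ^ Suc t) :: real)"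
      by (intro sum_nonneg) auto
    then show ?thesis using False by linarith
  qed
qed (use assms in simp)

text \<open>Truncation costs at most half of \<open>e\<close>, and the other half is shared by
  \<open>T\<close> layers. Finer levels come with higher probability, so fewer sets are needed where
  each set needs more samples.\<close>

lemma exists_likely_dyadic_level:
  fixes D :: "'a pmf" and X :: "'a \<Rightarrow> real"
  assumes X: "\<And>x. 0 \<le> X x" "\<And>x. X x \<le> 1"
    and e: "0 < e" "e \<le> measure_pmf.expectation D X" and T: "(1/2) ^ T \<le> e / 2"
  shows "\<exists>t<T. e * 2 ^ t / (2 * real T) \<le> measure_pmf.prob D {x. X x \<ge> (1/2) ^ Suc t}"
proof (rule ccontr)
  assume neg: "\<not> ?thesis"
  have T_pos: "T > 0"
  proof (rule ccontr)
    assume "\<not> T > 0"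
    then have "e \<ge> 2" using T by simp
    moreover have "measure_pmf.expectation D X \<le> 1"
      using X by (intro measure_pmf.integral_le_const measure_pmf.integrable_const_bound[where B = 1]) auto
    ultimately show False using e(2) by linarith
  qed
  have int_of_bool: "integrable D (\<lambda>x. (1/2) ^ t * of_bool (X x \<ge> (1/2) ^ Suc t) :: real)" for t
    by (intro measure_pmf.integrable_const_bound[where B = 1]) (auto simp: power_le_one)
  have int_X: "integrable D X"
    using X by (intro measure_pmf.integrable_const_bound[where B = 1]) auto
  have "e \<le> measure_pmf.expectation D X" by (rule e(2))
  also have "\<dots> \<le> measure_pmf.expectation D
      (\<lambda>x. (1/2) ^ T + (\<Sum>t<T. (1/2) ^ t * of_bool (X x \<ge> (1/2) ^ Suc t)))"
    using X by (intro integral_mono dyadic_layer_le int_X measure_pmf.integrable_const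
        Bochner_Integration.integrable_add Bochner_Integration.integrable_sum int_of_bool) auto
  also have "\<dots> = (1/2) ^ T + (\<Sum>t<T. measure_pmf.expectation D (\<lambda>x. (1/2) ^ t * of_bool (X x \<ge> (1/2) ^ Suc t)))"
    unfolding Bochner_Integration.integral_sum[OF int_of_bool]
      Bochner_Integration.integral_add[OF measure_pmf.integrable_const
        Bochner_Integration.integrable_sum[OF int_of_bool]]
    by simp
  also have "\<dots> = (1/2) ^ T + (\<Sum>t<T. (1/2) ^ t * measure_pmf.prob D {x. X x \<ge> (1/2) ^ Suc t})"
  proof -
    have "of_bool (X x \<ge> (1/2) ^ Suc t) = (indicator {x. X x \<ge> (1/2) ^ Suc t} x :: real)" for x t
      by (simp add: indicator_def)
    then show ?thesis by simp
  qed
  also have "(\<Sum>t<T. (1/2) ^ t * measure_pmf.prob D {x. X x \<ge> (1/2) ^ Suc t}) < (\<Sum>t<T. e / (2 * real T))"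
  proof (intro sum_strict_mono)
    fix t assume "t \<in> {..<T}"
    then have "measure_pmf.prob D {x. X x \<ge> (1/2) ^ Suc t} < e * 2 ^ t / (2 * real T)"
      using neg by (auto simp: not_le)
    then have "(1/2) ^ t * measure_pmf.prob D {x. X x \<ge> (1/2) ^ Suc t} < (1/2) ^ t * (e * 2 ^ t / (2 * real T))"
      by (intro mult_strict_left_mono) auto
    then show "(1/2) ^ t * measure_pmf.prob D {x. X x \<ge> (1/2) ^ Suc t} < e / (2 * real T)"
      by (simp add: power_one_over)
  qed (use T_pos in auto)
  also have "(\<Sum>t<T. e / (2 * real T)) = e / 2" using T_pos by simp
  finally show False using T by simp
qed

section \<open>Oracle answers and empirical frequencies\<close>

lemma cond_answers_append:
  "cond_answers p (Ss @ Ts) = bind_pmf (cond_answers p Ss) (\<lambda>xs. map_pmf ((@) xs) (cond_answers p Ts))"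
  by (induction Ss) (simp_all add: map_pmf_def bind_assoc_pmf bind_return_pmf bind_return_pmf')

lemma cond_answers_replicate:
  "cond_answers p (replicate M S) = replicate_pmf M (cond_oracle p S)"
  by (induction M) simp_all

lemma length_cond_answers: "xs \<in> set_pmf (cond_answers p Ss) \<Longrightarrow> length xs = length Ss"
  by (induction Ss arbitrary: xs) auto

text \<open>Transfers the counts to the binomial distribution, where Hoeffding's inequality gives
  \<open>frequency_deviation\<close>.\<close>

lemma map_count_list_replicate_pmf:
  "map_pmf (\<lambda>xs. count_list xs i) (replicate_pmf M D) = binomial_pmf M (pmf D i)"
proof (induction M)
  case 0
  show ?case by (simp add: binomial_pmf_0 pmf_le_1)
next
  case (Suc M)
  have bern: "bernoulli_pmf (pmf D i) = map_pmf (\<lambda>x. x = i) D"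
  proof (rule pmf_eqI)
    have "pmf (map_pmf (\<lambda>x. x = i) D) True = pmf D i"
      by (simp add: pmf_map vimage_def measure_pmf_single)
    moreover have "pmf (map_pmf (\<lambda>x. x = i) D) False = 1 - pmf (map_pmf (\<lambda>x. x = i) D) True"
      by (rule pmf_False_conv_True)
    ultimately show "pmf (bernoulli_pmf (pmf D i)) b = pmf (map_pmf (\<lambda>x. x = i) D) b" for b
      by (cases b) (simp_all add: pmf_le_1)
  qed
  have "binomial_pmf (Suc M) (pmf D i) = do {b \<leftarrow> bernoulli_pmf (pmf D i);
      k \<leftarrow> binomial_pmf M (pmf D i); return_pmf ((if b then 1 else 0) + k)}"
    by (rule binomial_pmf_Suc) (simp add: pmf_le_1)
  also have "\<dots> = map_pmf (\<lambda>xs. count_list xs i) (replicate_pmf (Suc M) D)"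
    unfolding bern Suc[symmetric]
    unfolding replicate_pmf.simps map_pmf_def bind_assoc_pmf bind_return_pmf
    by (intro bind_pmf_cong refl arg_cong[where f = return_pmf]) simp
  finally show ?case by simp
qed

lemma frequency_deviation:
  assumes "M > 0" "\<delta> \<ge> 0"
  shows "measure_pmf.prob (replicate_pmf M D) {xs. \<bar>real (count_list xs i) / real M - pmf D i\<bar> \<ge> \<delta>}
    \<le> 2 * exp (- 2 * real M * \<delta>\<^sup>2)"
proof -
  interpret binomial_distribution M "pmf D i" by unfold_locales (simp add: pmf_le_1)
  have "measure_pmf.prob (replicate_pmf M D) {xs. \<bar>real (count_list xs i) / real M - pmf D i\<bar> \<ge> \<delta>} =
      measure_pmf.prob (binomial_pmf M (pmf D i)) {x. \<bar>real x / real M - pmf D i\<bar> \<ge> \<delta>}"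
    by (simp add: vimage_def flip: map_count_list_replicate_pmf)
  also have "\<dots> \<le> 2 * exp (- 2 * real M * \<delta>\<^sup>2)"
    using prob_abs_ge'[of \<delta>] assms by simp
  finally show ?thesis .
qed

lemma prob_pair_pmf_disj_le:
  "measure_pmf.prob (pair_pmf P Q) {(x, y). A x \<or> B y}
    \<le> measure_pmf.prob P {x. A x} + measure_pmf.prob Q {y. B y}"
proof -
  have "measure_pmf.prob (pair_pmf P Q) {(x, y). A x \<or> B y} =
      measure_pmf.prob (pair_pmf P Q) (fst -` {x. A x} \<union> snd -` {y. B y})"
    by (intro arg_cong[of _ _ "measure_pmf.prob (pair_pmf P Q)"]) auto
  also have "\<dots> \<le> measure_pmf.prob (pair_pmf P Q) (fst -` {x. A x}) + measure_pmf.prob (pair_pmf P Q) (snd -` {y. B y})"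
    by (rule measure_Un_le) auto
  also have "\<dots> = measure_pmf.prob (map_pmf fst (pair_pmf P Q)) {x. A x}
      + measure_pmf.prob (map_pmf snd (pair_pmf P Q)) {y. B y}"
    by simp
  also have "\<dots> = measure_pmf.prob P {x. A x} + measure_pmf.prob Q {y. B y}"
    by (simp only: map_fst_pair_pmf map_snd_pair_pmf)
  finally show ?thesis .
qed

section \<open>The tester\<close>

text \<open>The threshold is halfway between the two cases to be separated: all true differences
  \<open>0\<close>, or some difference at least \<open>\<tau>\<close>.\<close>

definition similar_counts :: "nat \<Rightarrow> real \<Rightarrow> nat \<Rightarrow> nat list \<Rightarrow> nat list \<Rightarrow> bool" where
  "similar_counts n \<tau> M xs ys \<longleftrightarrow>
     (\<forall>i\<in>{1..n}. \<bar>real (count_list xs i) / real M - real (count_list ys i) / real M\<bar> < \<tau> / 2)"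

definition set_test :: "nat \<Rightarrow> nat pmf \<Rightarrow> nat pmf \<Rightarrow> real \<Rightarrow> nat \<Rightarrow> nat set \<Rightarrow> bool pmf" where
  "set_test n p q \<tau> M S = bind_pmf (cond_answers p (replicate M S)) (\<lambda>xs.
     bind_pmf (cond_answers q (replicate M S)) (\<lambda>ys. return_pmf (similar_counts n \<tau> M xs ys)))"

lemma set_test_eq:
  "set_test n p q \<tau> M S = map_pmf (\<lambda>(xs, ys). similar_counts n \<tau> M xs ys)
     (pair_pmf (replicate_pmf M (cond_oracle p S)) (replicate_pmf M (cond_oracle q S)))"
  by (simp add: set_test_def cond_answers_replicate pair_pmf_def map_pmf_def bind_assoc_pmf bind_return_pmf)

text \<open>If two frequencies with the same mean differ by \<open>\<tau> / 2\<close>, one of them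
  deviates by \<open>\<tau> / 4\<close>. The union bound over both samples and all elements gives
  the factor \<open>4 * n\<close>.\<close>

lemma set_test_complete:
  assumes "M > 0" "\<tau> \<ge> 0"
  shows "pmf (set_test n p p \<tau> M S) False \<le> 4 * real n * exp (- real M * \<tau>\<^sup>2 / 8)"
proof -
  let ?D = "cond_oracle p S" and ?R = "replicate_pmf M (cond_oracle p S)"
  let ?\<delta> = "\<tau> / 4"
  define dev where "dev i xs \<longleftrightarrow> \<bar>real (count_list xs i) / real M - pmf ?D i\<bar> \<ge> ?\<delta>" for i xs
  have "pmf (set_test n p p \<tau> M S) False =
      measure_pmf.prob (pair_pmf ?R ?R) {(xs, ys). \<not> similar_counts n \<tau> M xs ys}"
    unfolding set_test_eq pmf_map by (rule arg_cong[of _ _ "measure_pmf.prob _"]) auto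
  also have "\<dots> \<le> measure_pmf.prob (pair_pmf ?R ?R) (\<Union>i\<in>{1..n}. {(xs, ys). dev i xs \<or> dev i ys})"
  proof (intro measure_pmf.finite_measure_mono subsetI)
    fix z assume "z \<in> {(xs, ys). \<not> similar_counts n \<tau> M xs ys}"
    then obtain xs ys i where z: "z = (xs, ys)" "i \<in> {1..n}"
      "\<bar>real (count_list xs i) / real M - real (count_list ys i) / real M\<bar> \<ge> 2 * ?\<delta>"
      by (auto simp: similar_counts_def not_less)
    have "dev i xs \<or> dev i ys"
    proof (rule ccontr)
      assume "\<not> (dev i xs \<or> dev i ys)"
      then have "\<bar>real (count_list xs i) / real M - pmf ?D i\<bar> < ?\<delta>"
        "\<bar>real (count_list ys i) / real M - pmf ?D i\<bar> < ?\<delta>"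
        unfolding dev_def not_le de_Morgan_disj by blast+
      then show False using z(3) by linarith
    qed
    then show "z \<in> (\<Union>i\<in>{1..n}. {(xs, ys). dev i xs \<or> dev i ys})" using z by auto
  qed simp
  also have "\<dots> \<le> (\<Sum>i\<in>{1..n}. measure_pmf.prob (pair_pmf ?R ?R) {(xs, ys). dev i xs \<or> dev i ys})"
    by (rule measure_pmf.finite_measure_subadditive_finite) auto
  also have "\<dots> \<le> (\<Sum>i\<in>{1..n}. 4 * exp (- real M * \<tau>\<^sup>2 / 8))"
  proof (intro sum_mono)
    fix i
    have "measure_pmf.prob ?R {xs. dev i xs} \<le> 2 * exp (- real M * \<tau>\<^sup>2 / 8)"
      using frequency_deviation[OF assms(1), of ?\<delta> ?D i] assms(2) unfolding dev_def by (simp add: power_divide)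
    then show "measure_pmf.prob (pair_pmf ?R ?R) {(xs, ys). dev i xs \<or> dev i ys} \<le> 4 * exp (- real M * \<tau>\<^sup>2 / 8)"
      using prob_pair_pmf_disj_le[of ?R ?R "dev i" "dev i"] by linarith
  qed
  finally show ?thesis by simp
qed

text \<open>It suffices to watch one element attaining the discrepancy, so there is no union bound
  over elements and no factor \<open>n\<close>.\<close>

lemma set_test_sound:
  assumes "M > 0" "\<tau> \<ge> 0" "n \<ge> 1" "discrepancy n p q S \<ge> \<tau>"
  shows "pmf (set_test n p q \<tau> M S) True \<le> 4 * exp (- real M * \<tau>\<^sup>2 / 8)"
proof -
  let ?P = "replicate_pmf M (cond_oracle p S)" and ?Q = "replicate_pmf M (cond_oracle q S)"
  let ?\<delta> = "\<tau> / 4"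
  obtain i where i: "i \<in> {1..n}" "\<bar>pmf (cond_oracle p S) i - pmf (cond_oracle q S) i\<bar> \<ge> 4 * ?\<delta>"
    using discrepancy_attained[OF assms(3), of p q S] assms(4) by auto
  define dev where "dev D xs \<longleftrightarrow> \<bar>real (count_list xs i) / real M - pmf D i\<bar> \<ge> ?\<delta>" for D xs
  have dev: "measure_pmf.prob (replicate_pmf M D) {xs. dev D xs} \<le> 2 * exp (- real M * \<tau>\<^sup>2 / 8)" for D
    using frequency_deviation[OF assms(1), of ?\<delta> D i] assms(2) unfolding dev_def by (simp add: power_divide)
  have "pmf (set_test n p q \<tau> M S) True =
      measure_pmf.prob (pair_pmf ?P ?Q) {(xs, ys). similar_counts n \<tau> M xs ys}"
    unfolding set_test_eq pmf_map by (rule arg_cong[of _ _ "measure_pmf.prob _"]) auto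
  also have "\<dots> \<le> measure_pmf.prob (pair_pmf ?P ?Q) {(xs, ys). dev (cond_oracle p S) xs \<or> dev (cond_oracle q S) ys}"
  proof (intro measure_pmf.finite_measure_mono subsetI)
    fix z assume "z \<in> {(xs, ys). similar_counts n \<tau> M xs ys}"
    then obtain xs ys where z: "z = (xs, ys)"
      "\<bar>real (count_list xs i) / real M - real (count_list ys i) / real M\<bar> < 2 * ?\<delta>"
      using i(1) by (auto simp: similar_counts_def)
    have "dev (cond_oracle p S) xs \<or> dev (cond_oracle q S) ys"
    proof (rule ccontr)
      assume "\<not> ?thesis"
      then have "\<bar>real (count_list xs i) / real M - pmf (cond_oracle p S) i\<bar> < ?\<delta>"
        "\<bar>real (count_list ys i) / real M - pmf (cond_oracle q S) i\<bar> < ?\<delta>"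
        unfolding dev_def not_le de_Morgan_disj by blast+
      then show False using z(2) i(2) by linarith
    qed
    then show "z \<in> {(xs, ys). dev (cond_oracle p S) xs \<or> dev (cond_oracle q S) ys}" using z by auto
  qed simp
  also have "\<dots> \<le> 4 * exp (- real M * \<tau>\<^sup>2 / 8)"
    using prob_pair_pmf_disj_le[of ?P ?Q "dev (cond_oracle p S)" "dev (cond_oracle q S)"]
      dev[of "cond_oracle p S"] dev[of "cond_oracle q S"] by linarith
  finally show ?thesis .
qed

text \<open>Each list entry is one independent test: a fresh set repeated \<open>M t\<close> times.
  The blocks form one flat list, and \<open>accepts\<close> cuts the answers at the same
  places.\<close>

primrec draw_queries :: "nat set pmf \<Rightarrow> (nat \<Rightarrow> nat) \<Rightarrow> nat list \<Rightarrow> nat set list pmf" where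
  "draw_queries D M [] = return_pmf []"
| "draw_queries D M (t # ts) =
     bind_pmf D (\<lambda>S. map_pmf ((@) (replicate (M t) S)) (draw_queries D M ts))"

primrec accepts :: "nat \<Rightarrow> (nat \<Rightarrow> nat) \<Rightarrow> nat list \<Rightarrow> nat list \<Rightarrow> nat list \<Rightarrow> bool" where
  "accepts n M [] xs ys = True"
| "accepts n M (t # ts) xs ys \<longleftrightarrow>
     similar_counts n ((1/2) ^ Suc t) (M t) (take (M t) xs) (take (M t) ys) \<and>
     accepts n M ts (drop (M t) xs) (drop (M t) ys)"

text \<open>Both distributions get the same query list, so that the answers to one set can be
  compared.\<close>

definition tester :: "nat set pmf \<Rightarrow> nat \<Rightarrow> (nat \<Rightarrow> nat) \<Rightarrow> nat list \<Rightarrow> nacond_alg" where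
  "tester D n M ts = (map_pmf (\<lambda>Q. (0, Q, Q)) (draw_queries D M ts),
     \<lambda>_ xs ys. return_pmf (accepts n M ts xs ys))"

definition level_test :: "nat set pmf \<Rightarrow> nat \<Rightarrow> (nat \<Rightarrow> nat) \<Rightarrow> nat pmf \<Rightarrow> nat pmf \<Rightarrow> nat \<Rightarrow> bool pmf" where
  "level_test D n M p q t = bind_pmf D (set_test n p q ((1/2) ^ Suc t) (M t))"

lemma run_tester:
  "run_nacond (tester D n M ts) p q = bind_pmf (draw_queries D M ts) (\<lambda>Q.
     bind_pmf (cond_answers p Q) (\<lambda>xs. bind_pmf (cond_answers q Q) (\<lambda>ys.
       return_pmf (accepts n M ts xs ys))))"
  by (simp add: run_nacond_def tester_def bind_map_pmf)

lemma bind_cond_answers_append: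
  "bind_pmf (cond_answers p (Ss @ Ts)) f =
     bind_pmf (cond_answers p Ss) (\<lambda>xs. bind_pmf (cond_answers p Ts) (\<lambda>xs'. f (xs @ xs')))"
  by (simp add: cond_answers_append bind_assoc_pmf bind_map_pmf)

text \<open>The plan fixes all sets first, but each block has its own set and answers. By commuting
  independent draws the first block can be completed before the rest, so the run is a conjunction of
  independent tests.\<close>

lemma run_tester_Cons:
  "run_nacond (tester D n M (t # ts)) p q = bind_pmf (level_test D n M p q t)
     (\<lambda>b. map_pmf (\<lambda>c. b \<and> c) (run_nacond (tester D n M ts) p q))"
proof -
  let ?R = "\<lambda>S. replicate (M t) S" and ?sim = "similar_counts n ((1/2) ^ Suc t) (M t)"
  let ?Q = "draw_queries D M ts"
  have step: "bind_pmf ?Q (\<lambda>Q. bind_pmf (cond_answers p (?R S @ Q)) (\<lambda>xs.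
        bind_pmf (cond_answers q (?R S @ Q)) (\<lambda>ys. return_pmf (accepts n M (t # ts) xs ys)))) =
      bind_pmf (set_test n p q ((1/2) ^ Suc t) (M t) S)
        (\<lambda>b. map_pmf (\<lambda>c. b \<and> c) (run_nacond (tester D n M ts) p q))" (is "?lhs = ?rhs") for S
  proof -
    have "?lhs = bind_pmf ?Q (\<lambda>Q. bind_pmf (cond_answers p (?R S)) (\<lambda>xs. bind_pmf (cond_answers p Q) (\<lambda>xs'.
        bind_pmf (cond_answers q (?R S)) (\<lambda>ys. bind_pmf (cond_answers q Q) (\<lambda>ys'.
          return_pmf (?sim xs ys \<and> accepts n M ts xs' ys'))))))"
      unfolding bind_cond_answers_append
      by (intro bind_pmf_cong refl) (auto dest!: length_cond_answers)
    also have "\<dots> = bind_pmf (cond_answers p (?R S)) (\<lambda>xs. bind_pmf ?Q (\<lambda>Q.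
        bind_pmf (cond_answers q (?R S)) (\<lambda>ys. bind_pmf (cond_answers p Q) (\<lambda>xs'. bind_pmf (cond_answers q Q) (\<lambda>ys'.
          return_pmf (?sim xs ys \<and> accepts n M ts xs' ys'))))))"
      by (subst bind_commute_pmf) (intro bind_pmf_cong refl bind_commute_pmf)
    also have "\<dots> = bind_pmf (cond_answers p (?R S)) (\<lambda>xs. bind_pmf (cond_answers q (?R S)) (\<lambda>ys.
        bind_pmf ?Q (\<lambda>Q. bind_pmf (cond_answers p Q) (\<lambda>xs'. bind_pmf (cond_answers q Q) (\<lambda>ys'.
          return_pmf (?sim xs ys \<and> accepts n M ts xs' ys'))))))"
      by (intro bind_pmf_cong refl bind_commute_pmf)
    also have "\<dots> = ?rhs"
      by (simp add: set_test_def run_tester bind_assoc_pmf bind_return_pmf map_bind_pmf)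
    finally show ?thesis .
  qed
  show ?thesis
    unfolding level_test_def bind_assoc_pmf
    by (subst run_tester) (simp add: bind_assoc_pmf bind_map_pmf step del: accepts.simps)
qed

lemma pmf_bind_conj_True:
  "pmf (bind_pmf P (\<lambda>b. map_pmf (\<lambda>c. b \<and> c) Q)) True = pmf P True * pmf Q True"
proof -
  have "bind_pmf P (\<lambda>b. map_pmf (\<lambda>c. b \<and> c) Q) = map_pmf (\<lambda>(b, c). b \<and> c) (pair_pmf P Q)"
    by (simp add: pair_pmf_def map_pmf_def bind_assoc_pmf bind_return_pmf)
  moreover have "(\<lambda>(b, c). b \<and> c) -` {True} = {(True, True)}" by auto
  ultimately show ?thesis
    by (simp add: pmf_map measure_pmf_single pmf_pair)
qed

lemma pmf_run_tester_True:
  "pmf (run_nacond (tester D n M ts) p q) True = (\<Prod>t\<leftarrow>ts. pmf (level_test D n M p q t) True)"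
proof (induction ts)
  case Nil
  show ?case by (simp add: run_tester bind_return_pmf)
next
  case (Cons t ts)
  then show ?case by (simp add: run_tester_Cons pmf_bind_conj_True)
qed

lemma set_draw_queries:
  assumes "Q \<in> set_pmf (draw_queries D M ts)"
  shows "set Q \<subseteq> set_pmf D \<and> length Q = (\<Sum>t\<leftarrow>ts. M t)"
  using assms
proof (induction ts arbitrary: Q)
  case (Cons t ts)
  then obtain S Q' where "S \<in> set_pmf D" "Q' \<in> set_pmf (draw_queries D M ts)" "Q = replicate (M t) S @ Q'"
    by auto
  with Cons.IH[of Q'] show ?case by auto
qed simp

lemma tester_valid:
  assumes "\<And>S. S \<in> set_pmf D \<Longrightarrow> S \<noteq> {} \<and> S \<subseteq> {1..n}" "real (\<Sum>t\<leftarrow>ts. M t) \<le> m"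
  shows "nacond_valid n m (tester D n M ts)"
  unfolding nacond_valid_def
proof
  fix pl assume "pl \<in> set_pmf (fst (tester D n M ts))"
  then obtain Q where "pl = (0, Q, Q)" "Q \<in> set_pmf (draw_queries D M ts)"
    by (auto simp: tester_def)
  then show "(\<forall>S\<in>set (fst (snd pl)) \<union> set (snd (snd pl)). S \<noteq> {} \<and> S \<subseteq> {1..n}) \<and>
      real (length (fst (snd pl))) \<le> m \<and> real (length (snd (snd pl))) \<le> m"
    using set_draw_queries[of Q D M ts] assms by auto
qed

lemma level_test_complete:
  assumes "M t > 0"
  shows "1 - 4 * real n * exp (- real (M t) * ((1/2) ^ Suc t)\<^sup>2 / 8) \<le> pmf (level_test D n M p p t) True"
proof -
  let ?\<tau> = "(1/2) ^ Suc t :: real"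
  have "pmf (set_test n p p ?\<tau> (M t) S) True = 1 - pmf (set_test n p p ?\<tau> (M t) S) False" for S
    by (simp add: pmf_False_conv_True)
  then have "1 - 4 * real n * exp (- real (M t) * ?\<tau>\<^sup>2 / 8) \<le> pmf (set_test n p p ?\<tau> (M t) S) True" for S
    using set_test_complete[OF assms, of ?\<tau> n p S] by simp
  then show ?thesis
    unfolding level_test_def pmf_bind
    by (intro measure_pmf.integral_ge_const measure_pmf.integrable_const_bound[where B = 1])
      (auto simp: pmf_le_1)
qed

lemma level_test_sound:
  assumes M: "M t > 0" "4 * exp (- real (M t) * ((1/2) ^ Suc t)\<^sup>2 / 8) \<le> 1/2" and n: "n \<ge> 1"
  shows "pmf (level_test D n M p q t) True
    \<le> 1 - measure_pmf.prob D {S. discrepancy n p q S \<ge> (1/2) ^ Suc t} / 2"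
proof -
  let ?\<tau> = "(1/2) ^ Suc t :: real"
  let ?far = "{S. discrepancy n p q S \<ge> ?\<tau>}"
  have "pmf (set_test n p q ?\<tau> (M t) S) True \<le> 1 - indicator ?far S / 2" for S
  proof (cases "S \<in> ?far")
    case True
    then have "pmf (set_test n p q ?\<tau> (M t) S) True \<le> 4 * exp (- real (M t) * ?\<tau>\<^sup>2 / 8)"
      using M(1) n by (intro set_test_sound) auto
    then show ?thesis using M(2) True by simp
  qed (simp add: pmf_le_1)
  moreover have int: "integrable D (\<lambda>S. indicator ?far S / 2 :: real)"
    by (intro measure_pmf.integrable_const_bound[where B = 1]) (auto simp: indicator_def)
  ultimately have "pmf (level_test D n M p q t) True \<le> measure_pmf.expectation D (\<lambda>S. 1 - indicator ?far S / 2)"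
    unfolding level_test_def pmf_bind
    by (intro integral_mono measure_pmf.integrable_const_bound[where B = 1])
      (auto simp: pmf_le_1 indicator_def)
  also have "\<dots> = 1 - measure_pmf.prob D ?far / 2"
    unfolding Bochner_Integration.integral_diff[OF measure_pmf.integrable_const int] by simp
  finally show ?thesis .
qed

definition schedule :: "(nat \<Rightarrow> nat) \<Rightarrow> nat \<Rightarrow> nat list" where
  "schedule N T = concat (map (\<lambda>t. replicate (N t) t) [0..<T])"

lemma sum_list_schedule: "(\<Sum>t\<leftarrow>schedule N T. f t) = (\<Sum>t<T. N t * f t)" for f :: "nat \<Rightarrow> nat"
  by (induction T) (simp_all add: schedule_def sum_list_replicate)

lemma prod_list_schedule: "(\<Prod>t\<leftarrow>schedule N T. f t) = (\<Prod>t<T. f t ^ N t)" for f :: "nat \<Rightarrow> real"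
  by (induction T) (simp_all add: schedule_def)

lemma one_minus_power_le_exp:
  fixes x :: real
  assumes "x \<le> 1"
  shows "(1 - x) ^ k \<le> exp (- real k * x)"
proof -
  have "(1 - x) ^ k \<le> exp (- x) ^ k"
    using assms exp_ge_add_one_self[of "-x"] by (intro power_mono) auto
  also have "\<dots> = exp (- real k * x)" by (simp flip: exp_of_nat_mult)
  finally show ?thesis .
qed

lemma exp_minus_two_le: "exp (- 2 :: real) \<le> 1/3"
  using exp_ge_add_one_self[of "2 :: real"] by (simp add: exp_minus divide_simps)

text \<open>Bernoulli's inequality plays the role of a union bound over all tests.\<close>

lemma prod_ge_one_minus_sum:
  fixes f :: "nat \<Rightarrow> real" and \<eta> :: real
  assumes "\<And>t. t < T \<Longrightarrow> 1 - \<eta> \<le> f t" "0 \<le> \<eta>" "\<eta> \<le> 1"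
  shows "1 - real (\<Sum>t<T. N t) * \<eta> \<le> (\<Prod>t<T. f t ^ N t)"
proof -
  have "1 + real (\<Sum>t<T. N t) * (- \<eta>) \<le> (1 + - \<eta>) ^ (\<Sum>t<T. N t)"
    using assms by (intro Bernoulli_inequality) auto
  also have "\<dots> = (\<Prod>t<T. (1 - \<eta>) ^ N t)" by (simp add: power_sum)
  also have "\<dots> \<le> (\<Prod>t<T. f t ^ N t)"
    using assms by (intro prod_mono conjI power_mono) auto
  finally show ?thesis by simp
qed

lemma tester_complete:
  assumes M: "\<And>t. t < T \<Longrightarrow> M t > 0"
    "\<And>t. t < T \<Longrightarrow> 4 * real n * exp (- real (M t) * ((1/2) ^ Suc t)\<^sup>2 / 8) \<le> \<eta>"
    and \<eta>: "0 \<le> \<eta>" "\<eta> \<le> 1" "real (\<Sum>t<T. N t) * \<eta> \<le> 1/3"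
  shows "measure_pmf.prob (run_nacond (tester D n M (schedule N T)) p p) {True} \<ge> 2/3"
proof -
  have "1 - real (\<Sum>t<T. N t) * \<eta> \<le> (\<Prod>t<T. pmf (level_test D n M p p t) True ^ N t)"
    using level_test_complete[of M _ n D p, OF M(1)] M(2) \<eta> by (intro prod_ge_one_minus_sum) force+
  then show ?thesis
    using \<eta>(3) by (simp add: measure_pmf_single pmf_run_tester_True prod_list_schedule)
qed

text \<open>One level suffices, since the other factors of the acceptance probability are at most
  \<open>1\<close>. Each of its \<open>N t\<close> tests rejects with at least half the probability
  of drawing a discrepant set, so all accept with probability at most
  \<open>exp (- 2)\<close>.\<close>

lemma tester_sound:
  assumes M: "M t > 0" "4 * exp (- real (M t) * ((1/2) ^ Suc t)\<^sup>2 / 8) \<le> 1/2" and n: "n \<ge> 1"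
    and t: "t < T"
    and far: "4 \<le> real (N t) * measure_pmf.prob D {S. discrepancy n p q S \<ge> (1/2) ^ Suc t}"
  shows "measure_pmf.prob (run_nacond (tester D n M (schedule N T)) p q) {False} \<ge> 2/3"
proof -
  let ?a = "\<lambda>t. pmf (level_test D n M p q t) True"
  let ?\<kappa> = "measure_pmf.prob D {S. discrepancy n p q S \<ge> (1/2) ^ Suc t} / 2"
  have "(\<Prod>s<T. ?a s ^ N s) = ?a t ^ N t * (\<Prod>s\<in>{..<T} - {t}. ?a s ^ N s)"
    using t by (intro prod.remove) auto
  also have "\<dots> \<le> ?a t ^ N t * 1"
    by (intro mult_left_mono prod_le_1) (auto simp: power_le_one pmf_le_1)
  also have "\<dots> \<le> (1 - ?\<kappa>) ^ N t"
    using level_test_sound[of M t n D p q, OF M n] by (simp add: power_mono)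
  also have "\<dots> \<le> exp (- real (N t) * ?\<kappa>)"
    using measure_pmf.prob_le_1[of D "{S. discrepancy n p q S \<ge> (1/2) ^ Suc t}"]
    by (intro one_minus_power_le_exp) linarith
  also have "\<dots> \<le> exp (- 2)" using far by simp
  also have "\<dots> \<le> 1/3" by (rule exp_minus_two_le)
  finally show ?thesis
    by (simp add: measure_pmf_single pmf_False_conv_True pmf_run_tester_True prod_list_schedule)
qed

section \<open>Choice of the parameters\<close>

text \<open>Squaring \<open>1 + y \<le> exp y\<close> at \<open>y = x * ln 2 / 2\<close> gives a
  quadratic lower bound for \<open>2 powr x\<close> that exceeds \<open>x\<close>.\<close>

lemma log2_le_self:
  fixes x :: real
  assumes "x > 0"
  shows "log 2 x \<le> x"
proof -
  have "0 \<le> (x - 3/2)\<^sup>2" by simp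
  then have "x \<le> (1 + x / 3)\<^sup>2" by (simp add: power2_eq_square field_simps)
  also have "\<dots> \<le> (1 + x * ln 2 / 2)\<^sup>2"
    using ln2_ge_two_thirds assms by (intro power_mono) (auto simp: field_simps)
  also have "\<dots> \<le> exp (x * ln 2 / 2) ^ 2"
    using exp_ge_add_one_self[of "x * ln 2 / 2"] assms by (intro power_mono) auto
  also have "\<dots> = 2 powr x" by (simp add: powr_def flip: exp_of_nat_mult)
  finally show ?thesis using assms by (simp add: log_le_iff)
qed

text \<open>The quantity \<open>b\<close> absorbs the lower-order factors. The cost found is of
  order \<open>l ^ 11\<close>: \<open>l ^ 10\<close> from \<open>(1 / \<delta>)\<^sup>2\<close> and
  one \<open>l\<close> from \<open>H\<close>.\<close>

lemma exists_tester:
  fixes n :: nat and \<epsilon> :: real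
  assumes n: "n \<ge> 2" and \<epsilon>: "0 < \<epsilon>" "\<epsilon> \<le> 1"
  defines "l \<equiv> log 2 (real n)"
  defines "b \<equiv> 2 + log 2 (2 + l) + log 2 (1 / \<epsilon>)"
  shows "\<exists>A. nacond_valid n (1320 * 24 * 76 * 69120000\<^sup>2 * l ^ 12 / \<epsilon>\<^sup>2 * b ^ 18) A \<and>
    (\<forall>p q. is_dist_on n p \<and> is_dist_on n q \<longrightarrow>
      (p = q \<longrightarrow> measure_pmf.prob (run_nacond A p q) {True} \<ge> 2/3) \<and>
      (d_TV n p q \<ge> \<epsilon> \<longrightarrow> measure_pmf.prob (run_nacond A p q) {False} \<ge> 2/3))"
proof -
  define e where "e = log 2 (1 / \<epsilon>)"
  have l: "l \<ge> 1" using n by (simp add: l_def le_log_iff)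
  have e: "e \<ge> 0" using \<epsilon> by (simp add: e_def zero_le_log_cancel_iff)
  have "log 2 (2 + l) \<ge> 1" using l by (simp add: le_log_iff)
  then have b: "b \<ge> 3" "e \<le> b" "log 2 (2 + l) \<le> b" using e by (simp_all add: b_def e_def)
  have "log 2 l \<le> log 2 (2 + l)" using l by simp
  then have log_l: "log 2 l \<le> b" using b by linarith
  have log_b: "log 2 b \<le> b" using b by (intro log2_le_self) simp

  \<comment> \<open>As \<open>l + e\<close> is the logarithm of \<open>n / \<epsilon>\<close>,
    elements of mass at most \<open>(1/2) ^ Suc J\<close> have total mass at most
    \<open>\<epsilon> / 2\<close>.\<close>
  define J where "J = nat \<lceil>l + e\<rceil>"
  define r where "r = real J + 1"
  have J_ge: "l + e \<le> real J" and "real J \<le> l + e + 1"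
    using l e by (simp_all add: J_def) 
  have "2 * l + e \<le> 2 * l + l * e" using l e mult_right_mono[of 1 l e] by simp
  also have "\<dots> + l * log 2 (2 + l) = l * b" by (simp add: b_def e_def algebra_simps)
  finally have "l * b \<ge> 2 * l + e + l * log 2 (2 + l)" by simp
  moreover have "l * log 2 (2 + l) \<ge> 1 * 1" using l \<open>log 2 (2 + l) \<ge> 1\<close> by (intro mult_mono) auto
  ultimately have r: "1 \<le> r" "r \<le> l * b"
    using \<open>real J \<le> l + e + 1\<close> l by (simp_all add: r_def)
  have "real n / \<epsilon> = 2 powr (l + e)"
    using n \<epsilon> by (simp add: l_def e_def powr_add)
  also have "\<dots> \<le> 2 powr real J" using J_ge by simp
  finally have "real n / \<epsilon> \<le> 2 ^ J" by (simp add: powr_realpow)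
  then have J: "real n * (1/2) ^ Suc J \<le> \<epsilon> / 2"
    using \<epsilon> by (simp add: power_one_over field_simps)

  \<comment> \<open>The solution of
    \<open>exp (3 - \<Lambda> / 2) = \<epsilon> / (32768 * r ^ 4)\<close>.\<close>
  define \<Lambda> where "\<Lambda> = 6 + 2 * ln (32768 * r ^ 4 / \<epsilon>)"
  have big: "32768 * r ^ 4 / \<epsilon> \<ge> 1"
  proof -
    have "1 * 1 \<le> 32768 * r ^ 4" using r(1) by (intro mult_mono) auto
    then show ?thesis using \<epsilon> by (simp add: field_simps)
  qed
  have \<Lambda>_pos: "\<Lambda> \<ge> 1" using big by (simp add: \<Lambda>_def)
  have "exp (3 - \<Lambda> / 2) = exp (- ln (32768 * r ^ 4 / \<epsilon>))" 
    unfolding \<Lambda>_def by (simp add: add_divide_distrib)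
  also have "\<dots> = \<epsilon> / (32768 * r ^ 4)" using big \<epsilon> r(1) by (simp add: exp_minus)
  finally have \<Lambda>_exp: "exp (3 - \<Lambda> / 2) \<le> \<epsilon> / (32768 * (real J + 1) ^ 4)" by (simp add: r_def)
  have ln_le_log: "ln x \<le> log 2 x" if "x \<ge> 1" for x :: real
    using that ln_2_less_1 ln_ge_zero[of x] by (simp add: log_def field_simps mult_left_le)
  have "ln (32768 * r ^ 4 / \<epsilon>) \<le> log 2 (32768 * r ^ 4 / \<epsilon>)" using big by (rule ln_le_log)
  also have "\<dots> = 15 + 4 * log 2 r + e"
  proof -
    have "log 2 (32768 :: real) = 15" using log_pow_cancel[of "2 :: real" 15] by simp
    then show ?thesis using r(1) \<epsilon> by (simp add: e_def log_mult log_divide log_nat_power)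
  qed
  also have "log 2 r \<le> log 2 (l * b)" using r by simp
  also have "log 2 (l * b) = log 2 l + log 2 b" using l b by (simp add: log_mult)
  finally have \<Lambda>_le: "\<Lambda> \<le> 30 * b" using log_l log_b b by (simp add: \<Lambda>_def)

  \<comment> \<open>The expected discrepancy at the right density, divided by the number
    \<open>5 * r\<close> of candidate densities.\<close>
  define \<delta> where "\<delta> = \<epsilon> / (2560 * r ^ 5 * \<Lambda> ^ 3)"
  have "1 * 1 * 1 \<le> 2560 * r ^ 5 * \<Lambda> ^ 3" using r(1) \<Lambda>_pos by (intro mult_mono one_le_power) auto
  then have \<delta>: "\<delta> > 0" "\<delta> \<le> 1" using \<epsilon> by (simp_all add: \<delta>_def field_simps)
  have "1 / \<delta> = 2560 * r ^ 5 * \<Lambda> ^ 3 / \<epsilon>" by (simp add: \<delta>_def)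
  also have "\<dots> \<le> 2560 * (l * b) ^ 5 * (30 * b) ^ 3 / \<epsilon>"
    using r \<Lambda>_le \<Lambda>_pos \<epsilon> l b by (intro divide_right_mono mult_mono power_mono) auto
  also have "\<dots> = 69120000 * l ^ 5 * b ^ 8 / \<epsilon>"
    by (simp add: power_mult_distrib flip: power_add)
  finally have inv_\<delta>: "1 / \<delta> \<le> 69120000 * l ^ 5 * b ^ 8 / \<epsilon>" .
  have log_\<delta>: "log 2 (2 / \<delta>) \<le> 28 + 14 * b"
  proof -
    have "2 / \<delta> \<le> 2 ^ 28 * l ^ 5 * b ^ 8 / \<epsilon>"
    proof -
      have "2 / \<delta> \<le> 138240000 * (l ^ 5 * b ^ 8 / \<epsilon>)" using inv_\<delta> by simp
      also have "\<dots> \<le> 2 ^ 28 * (l ^ 5 * b ^ 8 / \<epsilon>)" using l b \<epsilon> by (intro mult_right_mono) auto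
      finally show ?thesis by simp
    qed
    then have "log 2 (2 / \<delta>) \<le> log 2 (2 ^ 28 * l ^ 5 * b ^ 8 / \<epsilon>)"
      using \<delta>(1) by (intro log_mono) auto
    also have "\<dots> = 28 + 5 * log 2 l + 8 * log 2 b + e"
    proof -
      have "log 2 (2 ^ 28 :: real) = 28" using log_pow_cancel[of "2 :: real" 28] by simp
      then show ?thesis using l b \<epsilon> by (simp add: e_def log_mult log_divide log_nat_power)
    qed
    finally show ?thesis using log_l log_b b by linarith
  qed

  define T where "T = nat \<lceil>log 2 (2 / \<delta>)\<rceil>"
  have log_ge1: "log 2 (2 / \<delta>) \<ge> 1" using \<delta> by (simp add: le_log_iff field_simps)
  then have T: "log 2 (2 / \<delta>) \<le> real T" "real T \<le> log 2 (2 / \<delta>) + 1" by (simp_all add: T_def)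
  then have T_pos: "T \<ge> 1" using log_ge1 by linarith
  have T_le: "real T \<le> 24 * b" using T(2) log_\<delta> b by linarith
  have "2 / \<delta> \<le> 2 powr real T" using T(1) \<delta> by (simp add: log_le_iff)
  then have "2 / \<delta> \<le> 2 ^ T" by (simp add: powr_realpow)
  then have T_half: "(1/2) ^ T \<le> \<delta> / 2" using \<delta>(1) by (simp add: power_one_over field_simps)
  have "2 powr real T \<le> 2 powr (log 2 (2 / \<delta>) + 1)" using T(2) by simp
  also have "\<dots> = 4 / \<delta>" using \<delta>(1) by (simp add: powr_add)
  finally have T_pow: "2 ^ T \<le> 4 / \<delta>" by (simp add: powr_realpow)

  \<comment> \<open>Four times the reciprocal of the probability
    \<open>\<delta> * 2 ^ t / (2 * real T)\<close> guaranteed at some level.\<close>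
  define N where "N t = nat \<lceil>8 * real T / (\<delta> * 2 ^ t)\<rceil>" for t
  have N_ge: "8 * real T / (\<delta> * 2 ^ t) \<le> real (N t)" for t
    using \<delta>(1) by (simp add: N_def)
  have N_le: "real (N t) \<le> 10 * real T / (\<delta> * 2 ^ t)" if "t < T" for t
  proof -
    have "2 * 2 ^ t \<le> (2 :: real) ^ T" using that power_increasing[of "Suc t" T "2 :: real"] by simp
    then have "2 ^ t \<le> 2 / \<delta>" using T_pow by simp
    then have "\<delta> * 2 ^ t \<le> 2" using \<delta>(1) by (simp add: field_simps)
    then have "1 \<le> 2 * real T / (\<delta> * 2 ^ t)" using T_pos \<delta>(1) by (simp add: field_simps)
    moreover have "real (N t) \<le> 8 * real T / (\<delta> * 2 ^ t) + 1"
      using \<delta>(1) by (simp add: N_def)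
    ultimately show ?thesis unfolding times_divide_eq_right[symmetric] by linarith
  qed
  define Q where "Q = 10 * (real T)\<^sup>2 / \<delta>"
  have "real (\<Sum>t<T. N t) \<le> (\<Sum>t<T. 10 * real T / \<delta>)"
    unfolding of_nat_sum
  proof (intro sum_mono)
    fix t assume "t \<in> {..<T}"
    then have "real (N t) \<le> 10 * real T / (\<delta> * 2 ^ t)" using N_le by simp
    also have "\<dots> \<le> 10 * real T / (\<delta> * 1)" using \<delta>(1) by (intro divide_left_mono mult_left_mono) auto
    finally show "real (N t) \<le> 10 * real T / \<delta>" by simp
  qed
  also have "\<dots> = Q" by (simp add: Q_def power2_eq_square)
  finally have N_sum: "real (\<Sum>t<T. N t) \<le> Q" .
  have Q_pos: "Q \<ge> 1"
  proof -
    have "1 * 1 \<le> 10 * (real T)\<^sup>2" using T_pos by (intro mult_mono) auto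
    then show ?thesis using \<delta> by (simp add: Q_def field_simps)
  qed

  \<comment> \<open>A test then errs with probability at most
    \<open>4 * n * exp (- H) = 1 / (3 * Q)\<close>, and there are at most \<open>Q\<close>
    tests.\<close>
  define H where "H = ln (12 * real n * Q)"
  have nQ: "real n * Q \<ge> 2 * 1" using n Q_pos by (intro mult_mono) auto
  then have nQ_pos: "0 < 12 * real n * Q" by linarith
  have H_ge: "H \<ge> 1"
  proof -
    have "exp 1 \<le> 12 * real n * Q" using nQ by (intro order_trans[OF exp_le]) linarith
    then show ?thesis unfolding H_def ln_ge_iff[OF nQ_pos] .
  qed
  have exp_H: "exp (- H) = 1 / (12 * real n * Q)"
    unfolding H_def exp_minus exp_ln[OF nQ_pos] by (rule inverse_eq_divide)
  have H_le: "H \<le> 76 * l * b"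
  proof -
    have "H \<le> log 2 (12 * real n * Q)" unfolding H_def using nQ by (intro ln_le_log) simp
    also have "\<dots> \<le> log 2 (2 ^ 7 * real n * (real T)\<^sup>2 * (2 / \<delta>))"
    proof -
      have "12 * real n * Q = 120 * (real n * (real T)\<^sup>2 / \<delta>)" by (simp add: Q_def)
      also have "\<dots> \<le> 256 * (real n * (real T)\<^sup>2 / \<delta>)" using \<delta>(1) by (intro mult_right_mono) auto
      finally show ?thesis using nQ_pos by (intro log_mono) (simp_all add: mult.assoc)
    qed
    also have "\<dots> = 7 + l + 2 * log 2 T + log 2 (2 / \<delta>)"
    proof -
      have log_prod: "log 2 (2 ^ 7 * x * y\<^sup>2 * z) = 7 + log 2 x + 2 * log 2 y + log 2 z"
        if "x > 0" "y > 0" "z > 0" for x y z :: real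
        using that log_pow_cancel[of "2 :: real" 7] by (simp add: log_mult log_nat_power)
      show ?thesis unfolding l_def using n T_pos \<delta>(1) by (intro log_prod) simp_all
    qed
    also have "log 2 (real T) \<le> real T" using T_pos by (intro log2_le_self) simp
    finally have "H \<le> 7 + l + 72 * b" using T(1) T_le by linarith
    also have "\<dots> \<le> 3 * (l * b) + l * b + 72 * (l * b)"
    proof -
      have "1 * 3 \<le> l * b" "l * 1 \<le> l * b" "1 * b \<le> l * b" using l b by (intro mult_mono; simp)+
      then show ?thesis by linarith
    qed
    finally show ?thesis by (simp add: mult_ac)
  qed

  \<comment> \<open>With \<open>\<tau> = (1/2) ^ Suc t\<close>, the exponent
    \<open>M t * \<tau>\<^sup>2 / 8\<close> equals \<open>M t / (32 * 4 ^ t)\<close>, which has to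
    reach \<open>H\<close>.\<close>
  define M where "M t = nat \<lceil>32 * (4 ^ t * H)\<rceil>" for t
  have M_ge: "32 * (4 ^ t * H) \<le> real (M t)" for t
    using H_ge by (simp add: M_def)
  have four_H: "1 \<le> 4 ^ t * H" for t
    using mult_mono[of 1 "4 ^ t" 1 H] H_ge by simp
  have M_pos: "M t > 0" for t
  proof -
    have "0 < real (M t)" using M_ge[of t] four_H[of t] by linarith
    then show ?thesis by simp
  qed
  have M_le: "real (M t) \<le> 33 * (4 ^ t * H)" for t
  proof -
    have "real (M t) \<le> 32 * (4 ^ t * H) + 1" using H_ge by (simp add: M_def)
    then show ?thesis using four_H[of t] by linarith
  qed
  have M_exp: "exp (- real (M t) * ((1/2) ^ Suc t)\<^sup>2 / 8) \<le> 1 / (12 * real n * Q)" for t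
  proof -
    have "((1/2 :: real) ^ Suc t)\<^sup>2 = 1 / (4 * 4 ^ t)"
      by (simp add: power2_eq_square power_one_over flip: power_mult_distrib)
    then have "H \<le> real (M t) * ((1/2) ^ Suc t)\<^sup>2 / 8"
      using M_ge[of t] by (simp add: field_simps)
    then have "exp (- real (M t) * ((1/2) ^ Suc t)\<^sup>2 / 8) \<le> exp (- H)" by simp
    then show ?thesis using exp_H by simp
  qed

  define D where "D = query_set n (5 * J + 4)"
  define A where "A = tester D n M (schedule N T)"
  have "real (\<Sum>t\<leftarrow>schedule N T. M t) = (\<Sum>t<T. real (N t) * real (M t))"
    by (simp add: sum_list_schedule)
  \<comment> \<open>The number of sets falls like \<open>2 ^ t\<close> while the repetitions grow
    like \<open>4 ^ t\<close>. The cost doubles with each level, and the geometric sum is governed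
    by \<open>2 ^ T \<le> 4 / \<delta>\<close>.\<close>
  also have "\<dots> \<le> (\<Sum>t<T. 330 * real T * H / \<delta> * 2 ^ t)"
  proof (intro sum_mono)
    fix t assume "t \<in> {..<T}"
    then have "real (N t) * real (M t) \<le> 10 * real T / (\<delta> * 2 ^ t) * (33 * (4 ^ t * H))"
      using N_le[of t] M_le[of t] \<delta>(1) by (intro mult_mono) auto
    also have "(4 :: real) ^ t = 2 ^ t * 2 ^ t" by (simp flip: power_mult_distrib)
    finally show "real (N t) * real (M t) \<le> 330 * real T * H / \<delta> * 2 ^ t"
      using \<delta>(1) by (simp add: field_simps)
  qed
  also have "\<dots> = 330 * real T * H / \<delta> * (2 ^ T - 1)"
  proof -
    have "(\<Sum>t<m. (2 :: real) ^ t) = 2 ^ m - 1" for m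
      by (induction m) simp_all
    then show ?thesis unfolding sum_distrib_left[symmetric] by simp
  qed
  also have "\<dots> \<le> 330 * real T * H / \<delta> * (4 / \<delta>)"
    using T_pow H_ge \<delta>(1) by (intro mult_left_mono) auto
  also have "\<dots> = 1320 * real T * H * (1 / \<delta>)\<^sup>2"
    by (simp add: power2_eq_square)
  also have "\<dots> \<le> 1320 * (24 * b) * (76 * l * b) * (69120000 * l ^ 5 * b ^ 8 / \<epsilon>)\<^sup>2"
    using T_le H_le H_ge inv_\<delta> \<delta>(1) b l by (intro mult_mono power_mono) auto
  also have "\<dots> = 1320 * 24 * 76 * 69120000\<^sup>2 * l ^ 11 / \<epsilon>\<^sup>2 * b ^ 18"
  proof -
    have powers: "l ^ 11 = l * (l ^ 5 * l ^ 5)" "b ^ 18 = b * b * (b ^ 8 * b ^ 8)"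
      by (simp_all add: eval_nat_numeral)
    have "1320 * (24 * b) * (76 * l * b) * (K * x * y / \<epsilon>)\<^sup>2
        = 1320 * 24 * 76 * K\<^sup>2 * (l * (x * x)) / \<epsilon>\<^sup>2 * (b * b * (y * y))" for K x y
      by (simp add: power2_eq_square mult_ac)
    then show ?thesis unfolding powers .
  qed
  also have "\<dots> \<le> 1320 * 24 * 76 * 69120000\<^sup>2 * l ^ 12 / \<epsilon>\<^sup>2 * b ^ 18"
    using l b by (intro mult_right_mono divide_right_mono mult_left_mono power_increasing) auto
  finally have valid: "nacond_valid n (1320 * 24 * 76 * 69120000\<^sup>2 * l ^ 12 / \<epsilon>\<^sup>2 * b ^ 18) A"
    unfolding A_def D_def using n set_query_set[of n] by (intro tester_valid) auto

  have complete: "measure_pmf.prob (run_nacond A p p) {True} \<ge> 2/3" for p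
    unfolding A_def
  proof (rule tester_complete[where \<eta> = "1 / (3 * Q)"])
    show "4 * real n * exp (- real (M t) * ((1/2) ^ Suc t)\<^sup>2 / 8) \<le> 1 / (3 * Q)" for t
    proof -
      have "4 * real n * exp (- real (M t) * ((1/2) ^ Suc t)\<^sup>2 / 8) \<le> 4 * real n * (1 / (12 * real n * Q))"
        by (intro mult_left_mono M_exp) simp
      also have "\<dots> = 1 / (3 * Q)" using n by simp
      finally show ?thesis .
    qed
    show "real (\<Sum>t<T. N t) * (1 / (3 * Q)) \<le> 1/3"
      using N_sum Q_pos by (simp add: field_simps)
  qed (use M_pos Q_pos in auto)

  have sound: "measure_pmf.prob (run_nacond A p q) {False} \<ge> 2/3"
    if dist: "is_dist_on n p" "is_dist_on n q" and far: "d_TV n p q \<ge> \<epsilon>" for p q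
  proof -
    have n1: "n \<ge> 1" using n by simp
    obtain j where j: "j \<le> 5 * J + 4" "\<epsilon> / (512 * (real J + 1) ^ 4 * \<Lambda> ^ 3)
        \<le> (\<Sum>S\<in>Pow {1..n}. subset_weight ((1/2) ^ j) {1..n} S * discrepancy n p q S)"
      using expected_discrepancy_at_some_rate[OF n1 dist \<epsilon>(1) far J _ \<Lambda>_exp] \<Lambda>_pos by auto
    have "discrepancy n p q {} = 0"
      using discrepancy_attained[OF n1, of p q "{}"] by (auto simp: cond_oracle_def)
    then have "\<epsilon> / (512 * (real J + 1) ^ 4 * \<Lambda> ^ 3) / (real (5 * J + 4) + 1)
        \<le> measure_pmf.expectation D (discrepancy n p q)"
      unfolding D_def using discrepancy_bounds[OF n1, of p q]
      by (intro expectation_query_set_ge[OF _ _ j]) auto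
    also have "\<epsilon> / (512 * (real J + 1) ^ 4 * \<Lambda> ^ 3) / (real (5 * J + 4) + 1) = \<delta>"
    proof -
      have "real (5 * J + 4) + 1 = 5 * r" by (simp add: r_def)
      then show ?thesis unfolding r_def[symmetric] by (simp add: \<delta>_def eval_nat_numeral mult_ac)
    qed
    finally have "\<delta> \<le> measure_pmf.expectation D (discrepancy n p q)" .
    then obtain t where t: "t < T"
      "\<delta> * 2 ^ t / (2 * real T) \<le> measure_pmf.prob D {S. discrepancy n p q S \<ge> (1/2) ^ Suc t}"
      using exists_likely_dyadic_level[of "discrepancy n p q" \<delta> D T] discrepancy_bounds[OF n1, of p q]
        \<delta>(1) T_half by blast
    show ?thesis
      unfolding A_def
    proof (rule tester_sound[OF M_pos _ n1 t(1)])
      have "8 \<le> 12 * real n * Q" using nQ by linarith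
      then have "1 / (12 * real n * Q) \<le> 1 / 8" by (rule frac_le[rotated 3]) simp_all
      then show "4 * exp (- real (M t) * ((1/2) ^ Suc t)\<^sup>2 / 8) \<le> 1/2"
        using M_exp[of t] by linarith
      have "4 = 8 * real T / (\<delta> * 2 ^ t) * (\<delta> * 2 ^ t / (2 * real T))"
        using \<delta>(1) T_pos by simp
      also have "\<dots> \<le> real (N t) * measure_pmf.prob D {S. discrepancy n p q S \<ge> (1/2) ^ Suc t}"
        using N_ge t(2) \<delta>(1) by (intro mult_mono) auto
      finally show "4 \<le> real (N t) * measure_pmf.prob D {S. discrepancy n p q S \<ge> (1/2) ^ Suc t}" .
    qed
  qed
  show ?thesis using valid complete sound by blast
qed

theorem theorem1:
  shows "\<exists>(C::real) (k::nat) (A :: nat \<Rightarrow> real \<Rightarrow> nacond_alg).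
     \<forall>n::nat. \<forall>\<epsilon>::real. n \<ge> 1 \<and> 0 < \<epsilon> \<and> \<epsilon> \<le> 1 \<longrightarrow>
       nacond_valid n
         (C * (log 2 (real n)) ^ 12 / \<epsilon>\<^sup>2
            * (2 + log 2 (2 + log 2 (real n)) + log 2 (1 / \<epsilon>)) ^ k)
         (A n \<epsilon>) \<and>
       (\<forall>p q. is_dist_on n p \<and> is_dist_on n q \<longrightarrow>
          (p = q \<longrightarrow> measure_pmf.prob (run_nacond (A n \<epsilon>) p q) {True} \<ge> 2/3) \<and>
          (d_TV n p q \<ge> \<epsilon> \<longrightarrow> measure_pmf.prob (run_nacond (A n \<epsilon>) p q) {False} \<ge> 2/3))"
proof -
  let ?good = "\<lambda>n \<epsilon> A. nacond_valid n
         (1320 * 24 * 76 * 69120000\<^sup>2 * (log 2 (real n)) ^ 12 / \<epsilon>\<^sup>2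
            * (2 + log 2 (2 + log 2 (real n)) + log 2 (1 / \<epsilon>)) ^ 18) A \<and>
       (\<forall>p q. is_dist_on n p \<and> is_dist_on n q \<longrightarrow>
          (p = q \<longrightarrow> measure_pmf.prob (run_nacond A p q) {True} \<ge> 2/3) \<and>
          (d_TV n p q \<ge> \<epsilon> \<longrightarrow> measure_pmf.prob (run_nacond A p q) {False} \<ge> 2/3))"
  have "\<exists>A. ?good n \<epsilon> A" if "n \<ge> 1" "0 < \<epsilon>" "\<epsilon> \<le> 1" for n \<epsilon>
  proof (cases "n = 1")
    case True
    \<comment> \<open>Here \<open>log 2 1 = 0\<close>, so no query is allowed. None is needed:
      \<open>{1}\<close> carries only one distribution, and the far case cannot occur.\<close>
    let ?A = "(return_pmf (0, [], []), \<lambda>_ _ _. return_pmf True) :: nacond_alg"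
    have "run_nacond ?A p q = return_pmf True" for p q
      by (simp add: run_nacond_def bind_return_pmf)
    moreover have "d_TV n p q = 0" if "is_dist_on n p" "is_dist_on n q" for p q
    proof -
      have "pmf p 1 = 1" "pmf q 1 = 1"
        using that sum_pmf_eq_1[of "{1..n}" p] sum_pmf_eq_1[of "{1..n}" q] True
        by (simp_all add: is_dist_on_def)
      then show ?thesis by (simp add: d_TV_def True)
    qed
    moreover have "nacond_valid n m ?A" if "m \<ge> 0" for m
      using that by (simp add: nacond_valid_def)
    ultimately show ?thesis
      using that True by (intro exI[of _ ?A]) (auto simp: measure_pmf_single)
  next
    case False
    then show ?thesis using exists_tester[of n \<epsilon>] that by simp
  qed
  then obtain A where "\<forall>n \<epsilon>. n \<ge> 1 \<and> 0 < \<epsilon> \<and> \<epsilon> \<le> 1 \<longrightarrow> ?good n \<epsilon> (A n \<epsilon>)"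
    by metis
  then show ?thesis by blast
qed

end
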